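(* Let $R$ be a commutative ring with unity and let $(A,\alpha),(B,\beta)$ be objects of $\operatorname{End}(\mathrm{FRel}(R))$. Then $(A,\alpha)$ and $(B,\beta)$ are isomorphic in the Szymczak category $\operatorname{Szym}(\mathrm{FRel}(R))$ if and only if $L(A,\alpha)$ and $L(B,\beta)$ are isomorphic in $\operatorname{End}(\mathrm{FRel}(R))$, where $L$ is the Leray functor.
   Context: Linear relations. For $R$-modules $M,N$, a linear relation $\varphi\colon M\multimap N$ is a submodule $\varphi\subseteq M\oplus N$. For $\varphi\colon M\multimap N$ and $\psi\colon N\multimap P$, $\psi\circ\varphi=\{(m,p)\in M\oplus P:\exists n\in N,\ (m,n)\in\varphi,\ (n,p)\in\psi\}$, and $\varphi^{-1}=\{(n,m):(m,n)\in\varphi\}\colon N\multimap M$. For a subset $S\subseteq M$, $\varphi(S)=\{n\in N:\exists m\in S,\ (m,n)\in\varphi\}$, and $\varphi(0)=\varphi(\{0\})$. For $\alpha\colon A\multimap A$, $\alpha^0=\operatorname{id}_A$, $\alpha^k$ is the $k$-fold composition and $\alpha^{-k}=(\alpha^{-1})^k$ for $k\in\mathbb N$ ($0\in\mathbb{N}$). Module homomorphisms are identified with their graphs. Categories. $\mathrm{Rel}(R)$ has $R$-modules as objects and linear relations as morphisms, with the composition of $\varphi\colon M\multimap N$ and $\psi\colon N\multimap P$ given by $\psi\circ\varphi=\{(m,p)\in M\oplus P:\exists n\in N,\ (m,n)\in\varphi,\ (n,p)\in\psi\}$; $\mathrm{FRel}(R)$ is its full subcategory on the $R$-modules of finite length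 (both Noetherian and Artinian). For a category $\mathcal C$, $\operatorname{End}(\mathcal C)$ has as objects pairs $(A,\alpha)$ with $A\in\mathcal C$ and $\alpha\colon A\to A$ a morphism of $\mathcal C$; morphisms $(A,\alpha)\to(B,\beta)$ are morphisms $\varphi\colon A\to B$ of $\mathcal C$ with $\varphi\circ\alpha=\beta\circ\varphi$. The Szymczak category $\operatorname{Szym}(\mathcal C)$ has the same objects as $\operatorname{End}(\mathcal C)$; its morphisms $(A,\alpha)\to(B,\beta)$ are equivalence classes $[\varphi,n]$ of pairs $(\varphi,n)$, with $\varphi\colon(A,\alpha)\to(B,\beta)$ a morphism of $\operatorname{End}(\mathcal C)$ and $n\in\mathbb N$, under $(\varphi,n)\equiv(\psi,m)\iff\exists k\in\mathbb N:\ \varphi\circ\alpha^{m+k}=\psi\circ\alpha^{n+k}$. Composition is $[\psi,m]\circ[\varphi,n]=[\psi\circ\varphi,m+n]$, and the identity of $(A,\alpha)$ is $[\operatorname{id}_A,0]$. Leray functor. For a linear relation $\alpha\colon A\multimap A$, $\operatorname{gker}\alpha$ is the submodule of $A$ generated by $\bigcup_{l\in\mathbb Z}\alpha^l(0)$, and $\operatorname{gim}\alpha=\bigcap_{l\in\mathbb Z}\alpha^l(A)$. Let $\iota_A\colon\operatorname{gim}\alpha\to A$ be the inclusion and $\pi_A\colon A\to A/\operatorname{gker}\alpha$ the canonical projection. Put $\operatorname{LE}(A,\alpha)=(\operatorname{gim}\alpha,\ \iota_A^{-1}\circ\alpha\circ\iota_A)$, $\operatorname{LM}(A,\alpha)=(A/\operatorname{gker}\alpha,\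 \pi_A\circ\alpha\circ\pi_A^{-1})$, and for a morphism $\varphi\colon(A,\alpha)\multimap(B,\beta)$, $\operatorname{LE}(\varphi)=\iota_B^{-1}\circ\varphi\circ\iota_A$, $\operatorname{LM}(\varphi)=\pi_B\circ\varphi\circ\pi_A^{-1}$. The Leray functor is $L=\operatorname{LE}\circ\operatorname{LM}$ (first apply $\operatorname{LM}$, then $\operatorname{LE}$). Since finite length passes to submodules and quotients, $L$ restricts to $\operatorname{End}(\mathrm{FRel}(R))$. *)

theory Defs
  imports "HOL-Algebra.Module" "HOL-Algebra.AbelCoset"
begin

section \<open>Categories, endomorphisms and the Szymczak category\<close>

text \<open>
  Hom-sets, composition and identities are indexed by objects, so an arrow need not
  carry its domain and codomain. \<open>Comp C X Y Z g f\<close> is \<open>g \<circ> f\<close> for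
  \<open>f : X \<rightarrow> Y\<close> and \<open>g : Y \<rightarrow> Z\<close>.
\<close>

record ('o, 'm) category =
  Obj :: "'o set"
  Hom :: "'o \<Rightarrow> 'o \<Rightarrow> 'm set"
  Comp :: "'o \<Rightarrow> 'o \<Rightarrow> 'o \<Rightarrow> 'm \<Rightarrow> 'm \<Rightarrow> 'm"
  Ident :: "'o \<Rightarrow> 'm"

definition isomorphic_in :: "('o, 'm) category \<Rightarrow> 'o \<Rightarrow> 'o \<Rightarrow> bool" where
  "isomorphic_in C X Y \<longleftrightarrow> X \<in> Obj C \<and> Y \<in> Obj C \<and>
     (\<exists>f \<in> Hom C X Y. \<exists>g \<in> Hom C Y X.
        Comp C X Y X g f = Ident C X \<and> Comp C Y X Y f g = Ident C Y)"

primrec endo_pow :: "('o, 'm) category \<Rightarrow> 'o \<Rightarrow> 'm \<Rightarrow> nat \<Rightarrow> 'm" where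
  "endo_pow C A \<alpha> 0 = Ident C A"
| "endo_pow C A \<alpha> (Suc n) = Comp C A A A \<alpha> (endo_pow C A \<alpha> n)"

definition End :: "('o, 'm) category \<Rightarrow> ('o \<times> 'm, 'm) category" where
  "End C =
    \<lparr>Obj = {(A, \<alpha>). A \<in> Obj C \<and> \<alpha> \<in> Hom C A A},
     Hom = (\<lambda>(A, \<alpha>) (B, \<beta>). {\<phi> \<in> Hom C A B. Comp C A A B \<phi> \<alpha> = Comp C A B B \<beta> \<phi>}),
     Comp = (\<lambda>X Y Z. Comp C (fst X) (fst Y) (fst Z)),
     Ident = (\<lambda>X. Ident C (fst X))\<rparr>"

definition szym_rel ::
  "('o, 'm) category \<Rightarrow> 'o \<times> 'm \<Rightarrow> 'o \<times> 'm \<Rightarrow> (('m \<times> nat) \<times> ('m \<times> nat)) set" where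
  "szym_rel C = (\<lambda>(A, \<alpha>) (B, \<beta>).
     {((\<phi>, n), (\<psi>, m)).
        \<phi> \<in> Hom (End C) (A, \<alpha>) (B, \<beta>) \<and> \<psi> \<in> Hom (End C) (A, \<alpha>) (B, \<beta>) \<and>
        (\<exists>k. Comp C A A B \<phi> (endo_pow C A \<alpha> (m + k)) = Comp C A A B \<psi> (endo_pow C A \<alpha> (n + k)))})"

definition szym_class ::
  "('o, 'm) category \<Rightarrow> 'o \<times> 'm \<Rightarrow> 'o \<times> 'm \<Rightarrow> 'm \<Rightarrow> nat \<Rightarrow> ('m \<times> nat) set" where
  "szym_class C X Y \<phi> n = szym_rel C X Y `` {(\<phi>, n)}"

text \<open>
  The composition of two classes is the union of the classes \<open>[\<psi> \<circ> \<phi>, m + n]\<close> over all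
  representatives; these all coincide when the category laws hold for \<open>C\<close>.
\<close>

definition Szym :: "('o, 'm) category \<Rightarrow> ('o \<times> 'm, ('m \<times> nat) set) category" where
  "Szym C =
    \<lparr>Obj = Obj (End C),
     Hom = (\<lambda>X Y. (Hom (End C) X Y \<times> UNIV) // szym_rel C X Y),
     Comp = (\<lambda>X Y Z G F. \<Union>(\<psi>, m) \<in> G. \<Union>(\<phi>, n) \<in> F.
               szym_class C X Z (Comp (End C) X Y Z \<psi> \<phi>) (m + n)),
     Ident = (\<lambda>X. szym_class C X X (Ident (End C) X) 0)\<rparr>"


section \<open>Modules\<close>

text \<open>
  The fields \<open>mult\<close> and \<open>one\<close>, which module records inherit from ring records, play no
  role for modules and are left unspecified.
\<close>

definition dsum_module ::
  "('r, 'a) module \<Rightarrow> ('r, 'b) module \<Rightarrow> ('r, 'a \<times> 'b) module" where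
  "dsum_module M N =
    \<lparr>carrier = carrier M \<times> carrier N, mult = undefined, one = undefined,
     zero = (\<zero>\<^bsub>M\<^esub>, \<zero>\<^bsub>N\<^esub>),
     add = (\<lambda>(x, y) (x', y'). (x \<oplus>\<^bsub>M\<^esub> x', y \<oplus>\<^bsub>N\<^esub> y')),
     smult = (\<lambda>r (x, y). (r \<odot>\<^bsub>M\<^esub> x, r \<odot>\<^bsub>N\<^esub> y))\<rparr>"

definition quot_module :: "('r, 'a) module \<Rightarrow> 'a set \<Rightarrow> ('r, 'a set) module" where
  "quot_module M H =
    \<lparr>carrier = a_rcosets\<^bsub>M\<^esub> H, mult = undefined, one = undefined,
     zero = H, add = set_add M,
     smult = (\<lambda>r X. \<Union>x\<in>X. H +>\<^bsub>M\<^esub> (r \<odot>\<^bsub>M\<^esub> x))\<rparr>"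

definition generated_submodule ::
  "('r, 'x) ring_scheme \<Rightarrow> ('r, 'a) module \<Rightarrow> 'a set \<Rightarrow> 'a set" where
  "generated_submodule R M S = \<Inter>{H. submodule H R M \<and> S \<subseteq> H}"

definition noetherian_module :: "('r, 'x) ring_scheme \<Rightarrow> ('r, 'a) module \<Rightarrow> bool" where
  "noetherian_module R M \<longleftrightarrow>
     (\<forall>N :: nat \<Rightarrow> 'a set. (\<forall>i. submodule (N i) R M) \<and> (\<forall>i. N i \<subseteq> N (Suc i)) \<longrightarrow>
        (\<exists>n. \<forall>i\<ge>n. N i = N n))"

definition artinian_module :: "('r, 'x) ring_scheme \<Rightarrow> ('r, 'a) module \<Rightarrow> bool" where
  "artinian_module R M \<longleftrightarrow>
     (\<forall>N :: nat \<Rightarrow> 'a set. (\<forall>i. submodule (N i) R M) \<and> (\<forall>i. N (Suc i) \<subseteq> N i) \<longrightarrow>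
        (\<exists>n. \<forall>i\<ge>n. N i = N n))"

definition finite_length :: "('r, 'x) ring_scheme \<Rightarrow> ('r, 'a) module \<Rightarrow> bool" where
  "finite_length R M \<longleftrightarrow> noetherian_module R M \<and> artinian_module R M"


section \<open>Linear relations\<close>

definition linear_relation ::
  "('r, 'x) ring_scheme \<Rightarrow> ('r, 'a) module \<Rightarrow> ('r, 'b) module \<Rightarrow> ('a \<times> 'b) set \<Rightarrow> bool" where
  "linear_relation R M N \<phi> \<longleftrightarrow> submodule \<phi> R (dsum_module M N)"

text \<open>
  The relational product \<^term>\<open>\<phi> O \<psi>\<close> is written in diagrammatic order, that is, it is
  \<open>\<psi> \<circ> \<phi>\<close>. The carrier type \<open>'a\<close> plays the role of the universe of modules.
\<close>

definition Rel :: "('r, 'x) ring_scheme \<Rightarrow> (('r, 'a) module, ('a \<times> 'a) set) category" where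
  "Rel R =
    \<lparr>Obj = {M. module R M},
     Hom = (\<lambda>M N. {\<phi>. linear_relation R M N \<phi>}),
     Comp = (\<lambda>M N P \<psi> \<phi>. \<phi> O \<psi>),
     Ident = (\<lambda>M. Id_on (carrier M))\<rparr>"

definition FRel :: "('r, 'x) ring_scheme \<Rightarrow> (('r, 'a) module, ('a \<times> 'a) set) category" where
  "FRel R = (Rel R)\<lparr>Obj := {M \<in> Obj (Rel R). finite_length R M}\<rparr>"

definition rel_int_pow ::
  "('r, 'x) ring_scheme \<Rightarrow> ('r, 'a) module \<Rightarrow> ('a \<times> 'a) set \<Rightarrow> int \<Rightarrow> ('a \<times> 'a) set" where
  "rel_int_pow R A \<alpha> l =
     (if 0 \<le> l then endo_pow (Rel R) A \<alpha> (nat l) else endo_pow (Rel R) A (\<alpha>\<inverse>) (nat (- l)))"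


section \<open>The Leray functor on objects\<close>

definition gker :: "('r, 'x) ring_scheme \<Rightarrow> ('r, 'a) module \<Rightarrow> ('a \<times> 'a) set \<Rightarrow> 'a set" where
  "gker R A \<alpha> = generated_submodule R A (\<Union>l::int. rel_int_pow R A \<alpha> l `` {\<zero>\<^bsub>A\<^esub>})"

definition gim :: "('r, 'x) ring_scheme \<Rightarrow> ('r, 'a) module \<Rightarrow> ('a \<times> 'a) set \<Rightarrow> 'a set" where
  "gim R A \<alpha> = (\<Inter>l::int. rel_int_pow R A \<alpha> l `` carrier A)"

definition incl_rel :: "'a set \<Rightarrow> ('a \<times> 'a) set" where
  "incl_rel H = {(x, x) | x. x \<in> H}"

definition proj_rel :: "('r, 'a) module \<Rightarrow> 'a set \<Rightarrow> ('a \<times> 'a set) set" where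
  "proj_rel M H = {(x, H +>\<^bsub>M\<^esub> x) | x. x \<in> carrier M}"

definition LE :: "('r, 'x) ring_scheme \<Rightarrow>
    ('r, 'a) module \<times> ('a \<times> 'a) set \<Rightarrow> ('r, 'a) module \<times> ('a \<times> 'a) set" where
  "LE R = (\<lambda>(A, \<alpha>). let I = gim R A \<alpha>; \<iota> = incl_rel I in
     (A\<lparr>carrier := I\<rparr>, \<iota> O \<alpha> O \<iota>\<inverse>))"

definition LM :: "('r, 'x) ring_scheme \<Rightarrow>
    ('r, 'a) module \<times> ('a \<times> 'a) set \<Rightarrow> ('r, 'a set) module \<times> ('a set \<times> 'a set) set" where
  "LM R = (\<lambda>(A, \<alpha>). let K = gker R A \<alpha>; \<pi> = proj_rel A K in
     (quot_module A K, \<pi>\<inverse> O \<alpha> O \<pi>))"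

definition Leray :: "('r, 'x) ring_scheme \<Rightarrow>
    ('r, 'a) module \<times> ('a \<times> 'a) set \<Rightarrow> ('r, 'a set) module \<times> ('a set \<times> 'a set) set" where
  "Leray R X = LE R (LM R X)"

end

theory Submission
  imports Defs
begin

text \<open>
  Both sides of the equivalence are expressed by shift equivalence. Two endorelations \<open>\<alpha>\<close> of \<open>A\<close> and
  \<open>\<beta>\<close> of \<open>B\<close> are shift equivalent if there are linear relations \<open>\<sigma>\<close> from \<open>A\<close> to \<open>B\<close> and \<open>\<tau>\<close> from \<open>B\<close> to \<open>A\<close>,
  commuting with \<open>\<alpha>\<close> and \<open>\<beta>\<close>, whose two composites are \<open>\<alpha> ^^ n\<close> and \<open>\<beta> ^^ n\<close>. An isomorphism in the Szymczak
  category is the same thing (\<open>Szym_isomorphic_iff_shift_equivalent\<close>), and if \<open>\<alpha>\<close> and \<open>\<beta>\<close> are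
  invertible, then so is an isomorphism of the endorelations themselves
  (\<open>End_isomorphic_iff_shift_equivalent\<close>). Shift equivalence is symmetric and transitive, so the
  theorem follows once the Leray reduction of \<open>(A, \<alpha>)\<close> is known to be an invertible endorelation
  that is shift equivalent to \<open>(A, \<alpha>)\<close>.

  The reduction first divides by the generalised kernel and then restricts to the generalised image. Each step
  is a subquotient: a surjective single-valued linear relation \<open>\<rho>\<close> from \<open>A\<close> to \<open>B\<close>, with
  \<open>\<rho>\<inverse> O \<alpha> O \<rho>\<close> as the new endorelation. Such a step is a shift equivalence as soon as inserting
  \<open>\<rho> O \<rho>\<inverse>\<close> between two steps of a path makes no difference, exactly if the path is long enough on
  both sides and up to \<open>\<rho> O \<rho>\<inverse>\<close> at its ends otherwise (\<open>shift_equivalent_subquotient\<close>). For the quotient this means that jumps within the generalised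
  kernel can be repaired, and it rests on a decomposition supplied by the ascending chain condition
  (\<open>gker_splits\<close>). For the submodule it means that the interior of a long path lies in the generalised
  image, by the descending chain condition (\<open>gim_between\<close>). On the quotient zero is related to zero
  only, so there the relation is single-valued and injective; on its generalised image it is also total
  and surjective, hence invertible.
\<close>

section \<open>Submodules and linear relations\<close>

lemma submodule_iff:
  assumes "module R M"
  shows "submodule H R M \<longleftrightarrow> H \<subseteq> carrier M \<and> \<zero>\<^bsub>M\<^esub> \<in> H \<and>
    (\<forall>x\<in>H. \<forall>y\<in>H. x \<oplus>\<^bsub>M\<^esub> y \<in> H) \<and> (\<forall>r\<in>carrier R. \<forall>x\<in>H. r \<odot>\<^bsub>M\<^esub> x \<in> H)"
proof -
  interpret module R M by fact
  show ?thesis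
  proof
    assume H: "submodule H R M"
    show "H \<subseteq> carrier M \<and> \<zero>\<^bsub>M\<^esub> \<in> H \<and>
      (\<forall>x\<in>H. \<forall>y\<in>H. x \<oplus>\<^bsub>M\<^esub> y \<in> H) \<and> (\<forall>r\<in>carrier R. \<forall>x\<in>H. r \<odot>\<^bsub>M\<^esub> x \<in> H)"
      using submoduleE[OF H] subgroup.one_closed[OF submodule.axioms(1)[OF H]] by auto
  next
    assume H: "H \<subseteq> carrier M \<and> \<zero>\<^bsub>M\<^esub> \<in> H \<and>
      (\<forall>x\<in>H. \<forall>y\<in>H. x \<oplus>\<^bsub>M\<^esub> y \<in> H) \<and> (\<forall>r\<in>carrier R. \<forall>x\<in>H. r \<odot>\<^bsub>M\<^esub> x \<in> H)"
    have "\<ominus>\<^bsub>M\<^esub> a \<in> H" if "a \<in> H" for a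
    proof -
      have "\<ominus>\<^bsub>M\<^esub> a = (\<ominus>\<^bsub>R\<^esub> \<one>\<^bsub>R\<^esub>) \<odot>\<^bsub>M\<^esub> a"
        using H that smult_l_minus[of "\<one>\<^bsub>R\<^esub>" a] by (simp add: subset_iff)
      then show ?thesis using H that by simp
    qed
    then show "submodule H R M" using H by (intro submoduleI) auto
  qed
qed

lemma submoduleD:
  assumes "module R M" and "submodule H R M"
  shows "H \<subseteq> carrier M" and "\<zero>\<^bsub>M\<^esub> \<in> H"
  using assms(2) by (simp_all add: submodule_iff[OF assms(1)])

lemma dsum_module_simps [simp]:
  "carrier (dsum_module M N) = carrier M \<times> carrier N"
  "\<zero>\<^bsub>dsum_module M N\<^esub> = (\<zero>\<^bsub>M\<^esub>, \<zero>\<^bsub>N\<^esub>)"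
  "(x, y) \<oplus>\<^bsub>dsum_module M N\<^esub> (x', y') = (x \<oplus>\<^bsub>M\<^esub> x', y \<oplus>\<^bsub>N\<^esub> y')"
  "r \<odot>\<^bsub>dsum_module M N\<^esub> (x, y) = (r \<odot>\<^bsub>M\<^esub> x, r \<odot>\<^bsub>N\<^esub> y)"
  by (simp_all add: dsum_module_def)

lemma module_dsum_module:
  assumes "module R M" and "module R N"
  shows "module R (dsum_module M N)"
proof -
  interpret M: module R M by fact
  interpret N: module R N by fact
  show ?thesis
  proof (rule moduleI)
    show "cring R" by (rule M.is_cring)
    show "abelian_group (dsum_module M N)"
    proof (rule abelian_groupI)
      fix p assume "p \<in> carrier (dsum_module M N)"
      then obtain x y where p: "p = (x, y)" "x \<in> carrier M" "y \<in> carrier N" by auto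
      show "\<exists>q\<in>carrier (dsum_module M N). q \<oplus>\<^bsub>dsum_module M N\<^esub> p = \<zero>\<^bsub>dsum_module M N\<^esub>"
        using p by (intro bexI[of _ "(\<ominus>\<^bsub>M\<^esub> x, \<ominus>\<^bsub>N\<^esub> y)"]) (auto simp: M.l_neg N.l_neg)
    qed (auto simp: M.a_ac N.a_ac)
  qed (auto simp: M.smult_l_distr N.smult_l_distr M.smult_r_distr N.smult_r_distr
      M.smult_assoc1 N.smult_assoc1)
qed

lemma linear_relation_iff:
  assumes "module R M" and "module R N"
  shows "linear_relation R M N \<phi> \<longleftrightarrow>
    \<phi> \<subseteq> carrier M \<times> carrier N \<and> (\<zero>\<^bsub>M\<^esub>, \<zero>\<^bsub>N\<^esub>) \<in> \<phi> \<and>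
    (\<forall>x y x' y'. (x, y) \<in> \<phi> \<longrightarrow> (x', y') \<in> \<phi> \<longrightarrow> (x \<oplus>\<^bsub>M\<^esub> x', y \<oplus>\<^bsub>N\<^esub> y') \<in> \<phi>) \<and>
    (\<forall>r x y. r \<in> carrier R \<longrightarrow> (x, y) \<in> \<phi> \<longrightarrow> (r \<odot>\<^bsub>M\<^esub> x, r \<odot>\<^bsub>N\<^esub> y) \<in> \<phi>)"
  unfolding linear_relation_def submodule_iff[OF module_dsum_module[OF assms]]
  by (simp only: Ball_def split_paired_All dsum_module_simps) blast

lemma linear_relationI:
  assumes "module R M" and "module R N"
    and "\<phi> \<subseteq> carrier M \<times> carrier N" and "(\<zero>\<^bsub>M\<^esub>, \<zero>\<^bsub>N\<^esub>) \<in> \<phi>"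
    and "\<And>x y x' y'. (x, y) \<in> \<phi> \<Longrightarrow> (x', y') \<in> \<phi> \<Longrightarrow> (x \<oplus>\<^bsub>M\<^esub> x', y \<oplus>\<^bsub>N\<^esub> y') \<in> \<phi>"
    and "\<And>r x y. r \<in> carrier R \<Longrightarrow> (x, y) \<in> \<phi> \<Longrightarrow> (r \<odot>\<^bsub>M\<^esub> x, r \<odot>\<^bsub>N\<^esub> y) \<in> \<phi>"
  shows "linear_relation R M N \<phi>"
  using assms by (simp add: linear_relation_iff)

lemma linear_relationD:
  assumes "linear_relation R M N \<phi>" and "module R M" and "module R N"
  shows "\<phi> \<subseteq> carrier M \<times> carrier N" and "(\<zero>\<^bsub>M\<^esub>, \<zero>\<^bsub>N\<^esub>) \<in> \<phi>"
    and "(x, y) \<in> \<phi> \<Longrightarrow> (x', y') \<in> \<phi> \<Longrightarrow> (x \<oplus>\<^bsub>M\<^esub> x', y \<oplus>\<^bsub>N\<^esub> y') \<in> \<phi>"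
    and "r \<in> carrier R \<Longrightarrow> (x, y) \<in> \<phi> \<Longrightarrow> (r \<odot>\<^bsub>M\<^esub> x, r \<odot>\<^bsub>N\<^esub> y) \<in> \<phi>"
    and "(x, y) \<in> \<phi> \<Longrightarrow> (x', y') \<in> \<phi> \<Longrightarrow> (x \<ominus>\<^bsub>M\<^esub> x', y \<ominus>\<^bsub>N\<^esub> y') \<in> \<phi>"
proof -
  interpret M: module R M by fact
  interpret N: module R N by fact
  note * = assms(1)[unfolded linear_relation_iff[OF assms(2,3)]]
  show 1: "\<phi> \<subseteq> carrier M \<times> carrier N" and "(\<zero>\<^bsub>M\<^esub>, \<zero>\<^bsub>N\<^esub>) \<in> \<phi>"
    using * by auto
  show add: "(x, y) \<in> \<phi> \<Longrightarrow> (x', y') \<in> \<phi> \<Longrightarrow> (x \<oplus>\<^bsub>M\<^esub> x', y \<oplus>\<^bsub>N\<^esub> y') \<in> \<phi>"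
    for x y x' y' using * by blast
  show smult: "r \<in> carrier R \<Longrightarrow> (x, y) \<in> \<phi> \<Longrightarrow> (r \<odot>\<^bsub>M\<^esub> x, r \<odot>\<^bsub>N\<^esub> y) \<in> \<phi>" for r x y
    using * by blast
  show "(x, y) \<in> \<phi> \<Longrightarrow> (x', y') \<in> \<phi> \<Longrightarrow> (x \<ominus>\<^bsub>M\<^esub> x', y \<ominus>\<^bsub>N\<^esub> y') \<in> \<phi>"
    using smult[of "\<ominus>\<^bsub>R\<^esub> \<one>\<^bsub>R\<^esub>" x' y'] add 1
    by (auto simp: subset_iff M.smult_l_minus N.smult_l_minus a_minus_def)
qed

lemma linear_relation_converse:
  assumes "linear_relation R M N \<phi>" and "module R M" and "module R N"
  shows "linear_relation R N M (\<phi>\<inverse>)"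
  using assms unfolding linear_relation_iff[OF assms(2,3)] linear_relation_iff[OF assms(3,2)]
  by blast

lemma linear_relation_relcomp:
  assumes "linear_relation R M N \<phi>" and "linear_relation R N P \<psi>"
    and "module R M" and "module R N" and "module R P"
  shows "linear_relation R M P (\<phi> O \<psi>)"
proof (rule linear_relationI[OF assms(3,5)])
  note \<phi> = linear_relationD[OF assms(1,3,4)]
  note \<psi> = linear_relationD[OF assms(2,4,5)]
  show "\<phi> O \<psi> \<subseteq> carrier M \<times> carrier P" using \<phi>(1) \<psi>(1) by blast
  show "(\<zero>\<^bsub>M\<^esub>, \<zero>\<^bsub>P\<^esub>) \<in> \<phi> O \<psi>" using \<phi>(2) \<psi>(2) by blast
  fix x z x' z' assume "(x, z) \<in> \<phi> O \<psi>" "(x', z') \<in> \<phi> O \<psi>"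
  then show "(x \<oplus>\<^bsub>M\<^esub> x', z \<oplus>\<^bsub>P\<^esub> z') \<in> \<phi> O \<psi>" by (blast intro: \<phi>(3) \<psi>(3))
next
  fix r x z assume "r \<in> carrier R" "(x, z) \<in> \<phi> O \<psi>"
  then show "(r \<odot>\<^bsub>M\<^esub> x, r \<odot>\<^bsub>P\<^esub> z) \<in> \<phi> O \<psi>"
    by (blast intro: linear_relationD(4)[OF assms(1,3,4)] linear_relationD(4)[OF assms(2,4,5)])
qed

lemma linear_relation_relpow:
  assumes "linear_relation R M M \<alpha>" and "module R M" and "0 < n"
  shows "linear_relation R M M (\<alpha> ^^ n)"
  using assms(3)
proof (induction n rule: nat_induct_non_zero)
  case 1
  then show ?case using assms(1) by (simp add: Id_O_R)
next
  case (Suc n)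
  then show ?case using linear_relation_relcomp assms by fastforce
qed

lemma submodule_Image:
  assumes "linear_relation R M N \<phi>" and "module R M" and "module R N" and "submodule H R M"
  shows "submodule (\<phi> `` H) R N"
  using assms(1,4) unfolding linear_relation_iff[OF assms(2,3)] submodule_iff[OF assms(2)]
    submodule_iff[OF assms(3)]
  by (intro conjI ballI) blast+

lemma submodule_zero:
  assumes "module R M"
  shows "submodule {\<zero>\<^bsub>M\<^esub>} R M"
proof -
  interpret module R M by fact
  show ?thesis by (simp add: submodule_iff[OF assms])
qed

lemma Id_on_relcomp: "\<phi> \<subseteq> C \<times> D \<Longrightarrow> Id_on C O \<phi> = \<phi>"
  by auto

lemma relcomp_Id_on: "\<phi> \<subseteq> C \<times> D \<Longrightarrow> \<phi> O Id_on D = \<phi>"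
  by auto

lemma converse_relpow: "(\<alpha> ^^ n)\<inverse> = (\<alpha>\<inverse>) ^^ n" for \<alpha> :: "('a \<times> 'a) set"
  by (induction n) (simp_all add: converse_relcomp relpow_commute)

text \<open>
  The condition on \<^term>\<open>\<rho>\<close> says that it is surjective and single-valued, so that \<open>N\<close> is a
  subquotient of \<open>M\<close>. Taking preimages then embeds the submodules of \<open>N\<close> into those of \<open>M\<close>
  and preserves inclusions, so chains stabilise in \<open>N\<close> because they do in \<open>M\<close>. The projection onto a
  quotient and the converse of an inclusion are the two instances used below.
\<close>

lemma finite_length_subquotient:
  fixes N :: "('r, 'b) module"
  assumes \<rho>: "linear_relation R M N \<rho>" and "module R M" and "module R N"
    and surj: "\<rho>\<inverse> O \<rho> = Id_on (carrier N)" and "finite_length R M"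
  shows "finite_length R N"
proof -
  have sub: "submodule (\<rho>\<inverse> `` H) R M" if "submodule H R N" for H
    using submodule_Image[OF linear_relation_converse[OF \<rho>] _ _ that] assms by simp
  have "\<rho> `` (\<rho>\<inverse> `` H) = H" if "submodule H R N" for H
  proof -
    have "\<rho> `` (\<rho>\<inverse> `` H) = (\<rho>\<inverse> O \<rho>) `` H" by blast
    then show ?thesis using that by (auto simp: surj submodule_iff[OF assms(3)])
  qed
  then have inj: "H = H'" if "submodule H R N" "submodule H' R N" "\<rho>\<inverse> `` H = \<rho>\<inverse> `` H'" for H H'
    using that by metis
  have mono: "H \<subseteq> H' \<Longrightarrow> \<rho>\<inverse> `` H \<subseteq> \<rho>\<inverse> `` H'" for H H'
    by blast
  have "\<exists>n. \<forall>i\<ge>n. \<rho>\<inverse> `` H i = \<rho>\<inverse> `` H n"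
    if "\<forall>i. submodule (H i) R N" "(\<forall>i. H i \<subseteq> H (Suc i)) \<or> (\<forall>i. H (Suc i) \<subseteq> H i)" for H :: "nat \<Rightarrow> 'b set"
    using that(2)
  proof
    assume "\<forall>i. H i \<subseteq> H (Suc i)"
    then show ?thesis using assms(5) sub mono that(1)
      unfolding finite_length_def noetherian_module_def
      by (elim conjE allE[of _ "\<lambda>i. \<rho>\<inverse> `` H i"]) blast
  next
    assume "\<forall>i. H (Suc i) \<subseteq> H i"
    then show ?thesis using assms(5) sub mono that(1)
      unfolding finite_length_def artinian_module_def
      by (elim conjE allE[of _ "\<lambda>i. \<rho>\<inverse> `` H i"]) blast
  qed
  then have "\<exists>n. \<forall>i\<ge>n. H i = H n"
    if "\<forall>i. submodule (H i) R N" "(\<forall>i. H i \<subseteq> H (Suc i)) \<or> (\<forall>i. H (Suc i) \<subseteq> H i)" for H :: "nat \<Rightarrow> 'b set"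
    using that inj by metis
  then show ?thesis unfolding finite_length_def noetherian_module_def artinian_module_def by blast
qed

section \<open>Shift equivalence\<close>

text \<open>
  Williams' relation from symbolic dynamics, for endorelations of modules whose carrier
  types may differ. Asking for a positive lag \<open>n\<close> loses nothing, since \<open>\<sigma>\<close> can be precomposed with
  \<open>\<alpha>\<close>; it makes \<^term>\<open>\<alpha> ^^ n\<close> the power in the category of modules, whereas
  \<^term>\<open>\<alpha> ^^ 0\<close> is the identity of the whole type and not of the carrier.
\<close>

definition shift_equivalent ::
  "('r, 'x) ring_scheme \<Rightarrow> ('r, 'a) module \<Rightarrow> ('a \<times> 'a) set \<Rightarrow>
    ('r, 'b) module \<Rightarrow> ('b \<times> 'b) set \<Rightarrow> bool" where
  "shift_equivalent R A \<alpha> B \<beta> \<longleftrightarrow> (\<exists>\<sigma> \<tau> n.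
     linear_relation R A B \<sigma> \<and> linear_relation R B A \<tau> \<and>
     \<alpha> O \<sigma> = \<sigma> O \<beta> \<and> \<beta> O \<tau> = \<tau> O \<alpha> \<and>
     0 < n \<and> \<sigma> O \<tau> = \<alpha> ^^ n \<and> \<tau> O \<sigma> = \<beta> ^^ n)"

lemma relpow_intertwine:
  assumes "\<alpha> O \<sigma> = \<sigma> O \<beta>"
  shows "\<alpha> ^^ n O \<sigma> = \<sigma> O \<beta> ^^ n"
proof (induction n)
  case (Suc n)
  have "\<alpha> ^^ Suc n O \<sigma> = \<alpha> ^^ n O \<alpha> O \<sigma>" by (simp add: O_assoc)
  also have "\<dots> = (\<alpha> ^^ n O \<sigma>) O \<beta>" by (simp add: O_assoc assms)
  also have "\<dots> = \<sigma> O \<beta> ^^ Suc n" by (simp add: Suc O_assoc)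
  finally show ?case .
qed simp

lemma shift_equivalent_sym:
  "shift_equivalent R A \<alpha> B \<beta> \<Longrightarrow> shift_equivalent R B \<beta> A \<alpha>"
  unfolding shift_equivalent_def by blast

text \<open>
  The lags add up: in \<open>\<sigma> \<sigma>' \<tau>' \<tau>\<close> the inner factor \<open>\<sigma>' \<tau>'\<close> is a power of \<open>\<beta>\<close>, which moves
  through \<open>\<sigma>\<close> and becomes the same power of \<open>\<alpha>\<close>.
\<close>

lemma shift_equivalent_trans:
  assumes "module R A" and "module R B" and "module R C"
    and "shift_equivalent R A \<alpha> B \<beta>" and "shift_equivalent R B \<beta> C \<gamma>"
  shows "shift_equivalent R A \<alpha> C \<gamma>"
proof -
  obtain \<sigma> \<tau> n where 1: "linear_relation R A B \<sigma>" "linear_relation R B A \<tau>"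
    "\<alpha> O \<sigma> = \<sigma> O \<beta>" "\<beta> O \<tau> = \<tau> O \<alpha>" "0 < n" "\<sigma> O \<tau> = \<alpha> ^^ n" "\<tau> O \<sigma> = \<beta> ^^ n"
    using assms(4) unfolding shift_equivalent_def by blast
  obtain \<sigma>' \<tau>' m where 2: "linear_relation R B C \<sigma>'" "linear_relation R C B \<tau>'"
    "\<beta> O \<sigma>' = \<sigma>' O \<gamma>" "\<gamma> O \<tau>' = \<tau>' O \<beta>" "0 < m" "\<sigma>' O \<tau>' = \<beta> ^^ m" "\<tau>' O \<sigma>' = \<gamma> ^^ m"
    using assms(5) unfolding shift_equivalent_def by blast
  show ?thesis
    unfolding shift_equivalent_def
  proof (intro exI conjI)
    show "linear_relation R A C (\<sigma> O \<sigma>')" "linear_relation R C A (\<tau>' O \<tau>)"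
      using linear_relation_relcomp[OF 1(1) 2(1)] linear_relation_relcomp[OF 2(2) 1(2)] assms(1-3)
      by simp_all
    show "\<alpha> O \<sigma> O \<sigma>' = (\<sigma> O \<sigma>') O \<gamma>"
      by (simp only: O_assoc[symmetric] 1(3)) (simp only: O_assoc 2(3))
    show "\<gamma> O \<tau>' O \<tau> = (\<tau>' O \<tau>) O \<alpha>"
      by (simp only: O_assoc[symmetric] 2(4)) (simp only: O_assoc 1(4))
    show "0 < m + n" using 1(5) by simp
    have "(\<sigma> O \<sigma>') O (\<tau>' O \<tau>) = (\<sigma> O \<beta> ^^ m) O \<tau>" by (simp only: O_assoc flip: 2(6))
    also have "\<dots> = \<alpha> ^^ m O \<sigma> O \<tau>" by (simp add: relpow_intertwine[OF 1(3), symmetric] O_assoc)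
    finally show "(\<sigma> O \<sigma>') O (\<tau>' O \<tau>) = \<alpha> ^^ (m + n)" by (simp add: 1(6) relpow_add)
    have "(\<tau>' O \<tau>) O (\<sigma> O \<sigma>') = \<tau>' O \<beta> ^^ n O \<sigma>'" by (simp only: O_assoc flip: 1(7))
    also have "\<dots> = (\<tau>' O \<sigma>') O \<gamma> ^^ n" by (simp add: relpow_intertwine[OF 2(3)] O_assoc)
    finally show "(\<tau>' O \<tau>) O (\<sigma> O \<sigma>') = \<gamma> ^^ (m + n)" by (simp add: 2(7) relpow_add)
  qed
qed

section \<open>Shift equivalence with a subquotient\<close>

text \<open>
  For a subquotient \<open>\<rho>\<close> of \<open>A\<close>, the relation \<^term>\<open>\<rho> O \<rho>\<inverse>\<close> on \<open>A\<close> is congruence modulo the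
  kernel if \<open>\<rho>\<close> is a projection, and the identity of a submodule if \<open>\<rho>\<close> is the converse of an
  inclusion. The collar is attached to an end of a path that is \<open>n\<close> steps away from the middle:
  it is trivial once \<open>n\<close> is at least \<open>N\<close>, and otherwise lets the end point vary modulo the kernel, or
  requires it to lie in the submodule.
\<close>

definition collar :: "nat \<Rightarrow> ('a \<times> 'b) set \<Rightarrow> nat \<Rightarrow> ('a \<times> 'a) set" where
  "collar N \<rho> n = (if N \<le> n then Id else \<rho> O \<rho>\<inverse>)"

text \<open>
  The hypothesis \<open>glue\<close> says that passing through \<^term>\<open>\<rho> O \<rho>\<inverse>\<close> in the middle of a path makes
  no difference, up to collars at its two ends. It makes \<open>\<alpha> ^^ N O \<rho>\<close> and \<open>\<rho>\<inverse> O \<alpha> ^^ N\<close> a shift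
  equivalence of lag \<open>2N\<close>: composing with \<open>\<rho>\<close> absorbs a collar, and next to \<open>\<alpha> ^^ N\<close> the collar is
  trivial. Reductions to quotients and to submodules both fit this pattern, with the two inclusions of
  \<open>glue\<close> exchanging their roles.
\<close>

lemma shift_equivalent_subquotient:
  assumes "module R A" and "module R B"
    and \<alpha>: "linear_relation R A A \<alpha>" and \<rho>: "linear_relation R A B \<rho>"
    and onto: "\<rho>\<inverse> O \<rho> = Id_on (carrier B)" and "0 < N"
    and glue: "\<And>n m. 0 < n \<Longrightarrow> 0 < m \<Longrightarrow>
      collar N \<rho> n O \<alpha> ^^ n O (\<rho> O \<rho>\<inverse>) O \<alpha> ^^ m O collar N \<rho> m =
      collar N \<rho> n O \<alpha> ^^ (n + m) O collar N \<rho> m"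
  shows "shift_equivalent R A \<alpha> B (\<rho>\<inverse> O \<alpha> O \<rho>)"
proof -
  let ?P = "collar N \<rho>" and ?\<beta> = "\<rho>\<inverse> O \<alpha> O \<rho>"
  note \<rho>_sub = linear_relationD(1)[OF \<rho> assms(1,2)]
  have "\<rho> O \<rho>\<inverse> O \<rho> = \<rho>" using \<rho>_sub by (simp add: onto relcomp_Id_on)
  then have right: "?P n O \<rho> = \<rho>" for n by (simp add: collar_def O_assoc)
  have "\<rho>\<inverse> O \<rho> O \<rho>\<inverse> = \<rho>\<inverse>" unfolding O_assoc[symmetric] onto using \<rho>_sub by auto
  then have left: "\<rho>\<inverse> O ?P n = \<rho>\<inverse>" for n by (simp add: collar_def)
  have glue_left: "\<rho>\<inverse> O \<alpha> ^^ n O (\<rho> O \<rho>\<inverse>) O \<alpha> ^^ m O ?P m = \<rho>\<inverse> O \<alpha> ^^ (n + m) O ?P m"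
    if "0 < n" "0 < m" for n m
    using arg_cong[OF glue[OF that], of "\<lambda>\<phi>. \<rho>\<inverse> O \<phi>"] by (simp add: left flip: O_assoc)
  have glue_right: "?P n O \<alpha> ^^ n O (\<rho> O \<rho>\<inverse>) O \<alpha> ^^ m O \<rho> = ?P n O \<alpha> ^^ (n + m) O \<rho>"
    if "0 < n" "0 < m" for n m
    using arg_cong[OF glue[OF that], of "\<lambda>\<phi>. \<phi> O \<rho>"] by (simp add: right O_assoc)
  have glue_both: "\<rho>\<inverse> O \<alpha> ^^ n O (\<rho> O \<rho>\<inverse>) O \<alpha> ^^ m O \<rho> = \<rho>\<inverse> O \<alpha> ^^ (n + m) O \<rho>"
    if "0 < n" "0 < m" for n m
    using arg_cong[OF glue_left[OF that], of "\<lambda>\<phi>. \<phi> O \<rho>"] by (simp add: right O_assoc)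
  have power: "?\<beta> ^^ n = \<rho>\<inverse> O \<alpha> ^^ n O \<rho>" if "0 < n" for n
    using that
  proof (induction n rule: nat_induct_non_zero)
    case (Suc n)
    have "?\<beta> ^^ Suc n = \<rho>\<inverse> O \<alpha> ^^ n O (\<rho> O \<rho>\<inverse>) O \<alpha> ^^ 1 O \<rho>"
      by (simp only: relpow.simps(2) Suc.IH O_assoc relpow_1)
    then show ?case using glue_both[OF Suc.hyps(1), of 1] by simp
  qed (simp add: Id_O_R)
  have free: "?P N = Id" by (simp add: collar_def)
  have pow: "linear_relation R A A (\<alpha> ^^ N)"
    by (rule linear_relation_relpow[OF \<alpha> assms(1) \<open>0 < N\<close>])
  show ?thesis
    unfolding shift_equivalent_def
  proof (intro exI conjI)
    show "linear_relation R A B (\<alpha> ^^ N O \<rho>)"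
      using linear_relation_relcomp[OF pow \<rho>] assms(1,2) by simp
    show "linear_relation R B A (\<rho>\<inverse> O \<alpha> ^^ N)"
      using linear_relation_relcomp[OF linear_relation_converse[OF \<rho>] pow] assms(1,2) by simp
    have "(\<alpha> ^^ N O \<rho>) O ?\<beta> = \<alpha> ^^ (N + 1) O \<rho>"
      using glue_right[OF \<open>0 < N\<close>, of 1] by (simp add: free O_assoc)
    then show "\<alpha> O \<alpha> ^^ N O \<rho> = (\<alpha> ^^ N O \<rho>) O ?\<beta>"
      by (simp add: O_assoc relpow_commute flip: O_assoc)
    have "?\<beta> O \<rho>\<inverse> O \<alpha> ^^ N = \<rho>\<inverse> O \<alpha> ^^ (1 + N)"
      using glue_left[OF _ \<open>0 < N\<close>, of 1] by (simp add: free O_assoc)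
    then show "?\<beta> O \<rho>\<inverse> O \<alpha> ^^ N = (\<rho>\<inverse> O \<alpha> ^^ N) O \<alpha>" by (simp add: O_assoc)
    show "0 < N + N" using \<open>0 < N\<close> by simp
    show "(\<alpha> ^^ N O \<rho>) O \<rho>\<inverse> O \<alpha> ^^ N = \<alpha> ^^ (N + N)"
      using glue[OF \<open>0 < N\<close> \<open>0 < N\<close>] by (simp add: free O_assoc)
    show "(\<rho>\<inverse> O \<alpha> ^^ N) O \<alpha> ^^ N O \<rho> = ?\<beta> ^^ (N + N)"
      using power[of "N + N"] \<open>0 < N\<close> by (simp add: relpow_add O_assoc)
  qed
qed

section \<open>Isomorphism in the Szymczak category is shift equivalence\<close>

definition intertwiners ::
  "('r, 'x) ring_scheme \<Rightarrow> ('r, 'a) module \<Rightarrow> ('a \<times> 'a) set \<Rightarrow>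
    ('r, 'b) module \<Rightarrow> ('b \<times> 'b) set \<Rightarrow> ('a \<times> 'b) set set" where
  "intertwiners R A \<alpha> B \<beta> = {\<phi>. linear_relation R A B \<phi> \<and> \<alpha> O \<phi> = \<phi> O \<beta>}"

lemma FRel_simps [simp]:
  "Obj (FRel R) = {M. module R M \<and> finite_length R M}"
  "Hom (FRel R) M N = {\<phi>. linear_relation R M N \<phi>}"
  "Comp (FRel R) M N P \<psi> \<phi> = \<phi> O \<psi>"
  "Ident (FRel R) M = Id_on (carrier M)"
  by (auto simp: FRel_def Rel_def)

lemma End_FRel_simps:
  "Obj (End (FRel R)) =
    {(A, \<alpha>). module R A \<and> finite_length R A \<and> linear_relation R A A \<alpha>}"
  "Hom (End (FRel R)) (A, \<alpha>) (B, \<beta>) = intertwiners R A \<alpha> B \<beta>"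
  "Comp (End (FRel R)) X Y Z \<psi> \<phi> = \<phi> O \<psi>"
  "Ident (End (FRel R)) (A, \<alpha>) = Id_on (carrier A)"
  by (auto simp: End_def intertwiners_def)

lemma endo_pow_FRel: "endo_pow (FRel R) A \<alpha> n = Id_on (carrier A) O \<alpha> ^^ n"
  by (induction n) (auto simp: O_assoc)

lemma endo_pow_FRel_relcomp:
  assumes "\<alpha> \<subseteq> carrier A \<times> carrier A" and "\<phi> \<subseteq> carrier A \<times> C"
  shows "endo_pow (FRel R) A \<alpha> n O \<phi> = \<alpha> ^^ n O \<phi>"
proof (cases n)
  case 0
  then show ?thesis using assms by (auto simp: endo_pow_FRel)
next
  case (Suc k)
  then have "\<alpha> ^^ n = \<alpha> O \<alpha> ^^ k" by (simp add: relpow_commute)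
  then show ?thesis using assms(1)
    by (metis Id_on_relcomp O_assoc endo_pow_FRel)
qed

text \<open>
  The powers formed in the category begin with the identity of the carrier, which disappears
  in front of a relation out of \<open>A\<close>. Plain relational powers can therefore be used.
\<close>

lemma szym_rel_FRel:
  assumes "module R A" and "module R B" and "linear_relation R A A \<alpha>"
  shows "((\<phi>, n), (\<psi>, m)) \<in> szym_rel (FRel R) (A, \<alpha>) (B, \<beta>) \<longleftrightarrow>
    \<phi> \<in> intertwiners R A \<alpha> B \<beta> \<and> \<psi> \<in> intertwiners R A \<alpha> B \<beta> \<and>
    (\<exists>k. \<alpha> ^^ (m + k) O \<phi> = \<alpha> ^^ (n + k) O \<psi>)"
proof -
  have "endo_pow (FRel R) A \<alpha> j O \<chi> = \<alpha> ^^ j O \<chi>" if "\<chi> \<in> intertwiners R A \<alpha> B \<beta>" for \<chi> j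
    using that assms
    by (intro endo_pow_FRel_relcomp) (auto simp: intertwiners_def dest!: linear_relationD(1))
  then show ?thesis by (simp add: szym_rel_def End_FRel_simps cong: conj_cong)
qed

lemma equiv_szym_rel_FRel:
  assumes "module R A" and "module R B" and "linear_relation R A A \<alpha>"
  shows "equiv (intertwiners R A \<alpha> B \<beta> \<times> UNIV) (szym_rel (FRel R) (A, \<alpha>) (B, \<beta>))"
proof (rule equivI)
  note iff = szym_rel_FRel[OF assms]
  show "szym_rel (FRel R) (A, \<alpha>) (B, \<beta>) \<subseteq>
    (intertwiners R A \<alpha> B \<beta> \<times> UNIV) \<times> (intertwiners R A \<alpha> B \<beta> \<times> UNIV)"
    by (auto simp: iff)
  show "refl_on (intertwiners R A \<alpha> B \<beta> \<times> UNIV) (szym_rel (FRel R) (A, \<alpha>) (B, \<beta>))"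
    by (auto simp: refl_on_def iff)
  show "sym (szym_rel (FRel R) (A, \<alpha>) (B, \<beta>))"
    unfolding sym_def split_paired_All iff by metis
  show "trans (szym_rel (FRel R) (A, \<alpha>) (B, \<beta>))"
    unfolding trans_def split_paired_All iff
  proof (intro allI impI; elim conjE exE; intro conjI)
    fix \<phi> n \<psi> m \<chi> l k j
    assume 1: "\<alpha> ^^ (m + k) O \<phi> = \<alpha> ^^ (n + k) O \<psi>"
      and 2: "\<alpha> ^^ (l + j) O \<psi> = \<alpha> ^^ (m + j) O \<chi>"
    have "\<alpha> ^^ (l + (m + k + j)) O \<phi> = \<alpha> ^^ (l + j) O \<alpha> ^^ (m + k) O \<phi>"
      by (simp add: add_ac flip: O_assoc relpow_add)
    also have "\<dots> = \<alpha> ^^ (n + k) O \<alpha> ^^ (l + j) O \<psi>"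
      unfolding 1 by (simp add: add_ac flip: O_assoc relpow_add)
    also have "\<dots> = \<alpha> ^^ (n + (m + k + j)) O \<chi>"
      unfolding 2 by (simp add: add_ac flip: O_assoc relpow_add)
    finally show "\<exists>k. \<alpha> ^^ (l + k) O \<phi> = \<alpha> ^^ (n + k) O \<chi>" by blast
  qed
qed

lemma Szym_simps:
  "Obj (Szym C) = Obj (End C)"
  "Hom (Szym C) X Y = (Hom (End C) X Y \<times> UNIV) // szym_rel C X Y"
  "Comp (Szym C) X Y Z G F = (\<Union>(\<psi>, m) \<in> G. \<Union>(\<phi>, n) \<in> F.
     szym_class C X Z (Comp (End C) X Y Z \<psi> \<phi>) (m + n))"
  "Ident (Szym C) X = szym_class C X X (Ident (End C) X) 0"
  by (simp_all add: Szym_def)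

lemma relcomp_in_intertwiners:
  assumes "module R A" and "module R B" and "module R C"
    and "\<phi> \<in> intertwiners R A \<alpha> B \<beta>" and "\<psi> \<in> intertwiners R B \<beta> C \<gamma>"
  shows "\<phi> O \<psi> \<in> intertwiners R A \<alpha> C \<gamma>"
  using assms linear_relation_relcomp[of R A B \<phi> C \<psi>]
  by (simp add: intertwiners_def) (metis O_assoc)

lemma linear_relation_Id_on:
  assumes "module R A"
  shows "linear_relation R A A (Id_on (carrier A))"
proof -
  interpret module R A by fact
  show ?thesis by (rule linear_relationI[OF assms assms]) auto
qed

lemma Id_on_in_intertwiners:
  assumes "module R A" and "linear_relation R A A \<alpha>"
  shows "Id_on (carrier A) \<in> intertwiners R A \<alpha> A \<alpha>"
  using assms linear_relationD(1)[OF assms(2,1,1)]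
  by (simp add: intertwiners_def linear_relation_Id_on Id_on_relcomp relcomp_Id_on)

text \<open>
  The composition of two classes is a union over all representatives, so every pair of
  representatives has to be shown to give the class of the identity; this is the usual argument
  that composition of classes is well defined, run only for a pair with \<open>\<sigma> O \<tau> = \<alpha> ^^ (n + m)\<close>.
\<close>

lemma Szym_comp_eq_Ident:
  assumes "module R A" and "module R B"
    and \<alpha>: "linear_relation R A A \<alpha>" and \<beta>: "linear_relation R B B \<beta>"
    and \<sigma>: "\<sigma> \<in> intertwiners R A \<alpha> B \<beta>" and \<tau>: "\<tau> \<in> intertwiners R B \<beta> A \<alpha>"
    and "\<sigma> O \<tau> = \<alpha> ^^ (n + m)" and "0 < n + m"
  shows "Comp (Szym (FRel R)) (A, \<alpha>) (B, \<beta>) (A, \<alpha>)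
      (szym_class (FRel R) (B, \<beta>) (A, \<alpha>) \<tau> m) (szym_class (FRel R) (A, \<alpha>) (B, \<beta>) \<sigma> n) =
    Ident (Szym (FRel R)) (A, \<alpha>)"
    (is "Comp _ _ _ _ ?G ?F = ?I")
proof -
  note iff = szym_rel_FRel[OF assms(1-3)] szym_rel_FRel[OF assms(2,1,4)]
  have "szym_class (FRel R) (A, \<alpha>) (A, \<alpha>) (\<phi> O \<psi>) (m' + n') = ?I"
    if mem: "(\<psi>, m') \<in> ?G" "(\<phi>, n') \<in> ?F" for \<phi> \<psi> m' n'
  proof -
    obtain k j where k: "\<alpha> ^^ (n' + k) O \<sigma> = \<alpha> ^^ (n + k) O \<phi>"
      and j: "\<beta> ^^ (m' + j) O \<tau> = \<beta> ^^ (m + j) O \<psi>"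
      and \<phi>: "\<phi> \<in> intertwiners R A \<alpha> B \<beta>" and \<psi>: "\<psi> \<in> intertwiners R B \<beta> A \<alpha>"
      using mem unfolding szym_class_def Image_singleton_iff iff by blast
    have \<sigma>\<beta>: "\<alpha> ^^ i O \<sigma> = \<sigma> O \<beta> ^^ i" for i
      by (rule relpow_intertwine) (use \<sigma> in \<open>simp add: intertwiners_def\<close>)
    have Id: "\<alpha> ^^ i O Id_on (carrier A) = \<alpha> ^^ i" if "0 < i" for i
      using linear_relationD(1)[OF linear_relation_relpow[OF \<alpha> _ that]] assms(1)
      by (simp add: relcomp_Id_on)
    have "\<alpha> ^^ (0 + (n + k + m + j)) O \<phi> O \<psi> = \<alpha> ^^ (m + j) O (\<alpha> ^^ (n + k) O \<phi>) O \<psi>"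
      by (simp add: add_ac flip: O_assoc relpow_add)
    also have "\<dots> = \<alpha> ^^ (n' + k) O (\<alpha> ^^ (m + j) O \<sigma>) O \<psi>"
      unfolding k[symmetric] by (simp add: add_ac flip: O_assoc relpow_add)
    also have "\<dots> = \<alpha> ^^ (n' + k) O \<sigma> O \<beta> ^^ (m' + j) O \<tau>"
      unfolding \<sigma>\<beta> j by (simp add: O_assoc)
    also have "\<dots> = \<alpha> ^^ (n' + k) O (\<alpha> ^^ (m' + j) O \<sigma>) O \<tau>"
      unfolding \<sigma>\<beta> by (simp add: O_assoc)
    also have "\<dots> = \<alpha> ^^ (m' + n' + (n + k + m + j))"
      by (simp add: O_assoc assms(7)) (simp add: add_ac flip: O_assoc relpow_add)
    also have "\<dots> = \<alpha> ^^ (m' + n' + (n + k + m + j)) O Id_on (carrier A)"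
      using assms(8) by (subst Id) auto
    finally have "((\<phi> O \<psi>, m' + n'), (Id_on (carrier A), 0)) \<in> szym_rel (FRel R) (A, \<alpha>) (A, \<alpha>)"
      using relcomp_in_intertwiners[OF _ _ _ \<phi> \<psi>] Id_on_in_intertwiners[OF assms(1) \<alpha>] assms(1-4)
      unfolding szym_rel_FRel[OF assms(1) assms(1) \<alpha>] by blast
    then show ?thesis unfolding szym_class_def Szym_simps End_FRel_simps
      by (rule equiv_class_eq[OF equiv_szym_rel_FRel[OF assms(1) assms(1) \<alpha>]])
  qed
  moreover have "(\<sigma>, n) \<in> ?F" "(\<tau>, m) \<in> ?G"
    using \<sigma> \<tau> by (auto simp: szym_class_def iff)
  ultimately show ?thesis unfolding Szym_simps(3) End_FRel_simps by fast
qed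

text \<open>
  If \<open>[\<phi>, n]\<close> and \<open>[\<psi>, m]\<close> are mutually inverse, then \<open>\<alpha> ^^ k O \<phi> O \<psi> = \<alpha> ^^ (m + n + k)\<close>
  for some \<open>k\<close>, and similarly for \<open>\<beta>\<close> and some \<open>j\<close>. Absorbing enough powers of \<open>\<alpha>\<close> into \<open>\<phi>\<close> turns
  both equations into those of a shift equivalence. Conversely, a shift equivalence \<open>(\<sigma>, \<tau>)\<close> of lag \<open>n\<close>
  gives the inverse isomorphisms \<open>[\<sigma>, 0]\<close> and \<open>[\<tau>, n]\<close>.
\<close>

lemma Szym_isomorphic_iff_shift_equivalent:
  fixes A B :: "('r, 'a) module"
  assumes "(A, \<alpha>) \<in> Obj (End (FRel R))" and "(B, \<beta>) \<in> Obj (End (FRel R))"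
  shows "isomorphic_in (Szym (FRel R)) (A, \<alpha>) (B, \<beta>) \<longleftrightarrow> shift_equivalent R A \<alpha> B \<beta>"
proof -
  have A: "module R A" and B: "module R B"
    and \<alpha>: "linear_relation R A A \<alpha>" and \<beta>: "linear_relation R B B \<beta>"
    using assms by (auto simp: End_FRel_simps)
  have Id: "\<gamma> ^^ i O Id_on (carrier C) = \<gamma> ^^ i"
    if "module R C" "linear_relation R C C \<gamma>" "0 < i" for \<gamma> i and C :: "('r, 'a) module"
    using linear_relationD(1)[OF linear_relation_relpow[OF that(2,1,3)] that(1,1)]
    by (rule relcomp_Id_on)
  show ?thesis
  proof
    assume "isomorphic_in (Szym (FRel R)) (A, \<alpha>) (B, \<beta>)"
    then obtain F G where F: "F \<in> Hom (Szym (FRel R)) (A, \<alpha>) (B, \<beta>)"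
      and G: "G \<in> Hom (Szym (FRel R)) (B, \<beta>) (A, \<alpha>)"
      and GF: "Comp (Szym (FRel R)) (A, \<alpha>) (B, \<beta>) (A, \<alpha>) G F = Ident (Szym (FRel R)) (A, \<alpha>)"
      and FG: "Comp (Szym (FRel R)) (B, \<beta>) (A, \<alpha>) (B, \<beta>) F G = Ident (Szym (FRel R)) (B, \<beta>)"
      unfolding isomorphic_in_def by blast
    obtain \<phi> n where \<phi>: "\<phi> \<in> intertwiners R A \<alpha> B \<beta>" "(\<phi>, n) \<in> F"
      using F equiv_class_self[OF equiv_szym_rel_FRel[OF A B \<alpha>]]
      by (fastforce simp: Szym_simps End_FRel_simps elim!: quotientE)
    obtain \<psi> m where \<psi>: "\<psi> \<in> intertwiners R B \<beta> A \<alpha>" "(\<psi>, m) \<in> G"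
      using G equiv_class_self[OF equiv_szym_rel_FRel[OF B A \<beta>]]
      by (fastforce simp: Szym_simps End_FRel_simps elim!: quotientE)
    have "(\<phi> O \<psi>, m + n) \<in> szym_class (FRel R) (A, \<alpha>) (A, \<alpha>) (\<phi> O \<psi>) (m + n)"
      using relcomp_in_intertwiners[OF A B A \<phi>(1) \<psi>(1)]
      by (auto simp: szym_class_def szym_rel_FRel[OF A A \<alpha>])
    then have "(\<phi> O \<psi>, m + n) \<in> Comp (Szym (FRel R)) (A, \<alpha>) (B, \<beta>) (A, \<alpha>) G F"
      using \<phi>(2) \<psi>(2) unfolding Szym_simps End_FRel_simps by blast
    then have "(\<phi> O \<psi>, m + n) \<in> Ident (Szym (FRel R)) (A, \<alpha>)" unfolding GF .
    then obtain k where k: "\<alpha> ^^ (m + n + k) O Id_on (carrier A) = \<alpha> ^^ k O \<phi> O \<psi>"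
      by (auto simp: Szym_simps End_FRel_simps szym_class_def szym_rel_FRel[OF A A \<alpha>])
    have "(\<psi> O \<phi>, n + m) \<in> szym_class (FRel R) (B, \<beta>) (B, \<beta>) (\<psi> O \<phi>) (n + m)"
      using relcomp_in_intertwiners[OF B A B \<psi>(1) \<phi>(1)]
      by (auto simp: szym_class_def szym_rel_FRel[OF B B \<beta>])
    then have "(\<psi> O \<phi>, n + m) \<in> Comp (Szym (FRel R)) (B, \<beta>) (A, \<alpha>) (B, \<beta>) F G"
      using \<phi>(2) \<psi>(2) unfolding Szym_simps End_FRel_simps by blast
    then have "(\<psi> O \<phi>, n + m) \<in> Ident (Szym (FRel R)) (B, \<beta>)" unfolding FG .
    then obtain j where j: "\<beta> ^^ (n + m + j) O Id_on (carrier B) = \<beta> ^^ j O \<psi> O \<phi>"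
      by (auto simp: Szym_simps End_FRel_simps szym_class_def szym_rel_FRel[OF B B \<beta>])
    \<comment> \<open>\<open>k + j\<close> allows both equations to be used, the successor makes the lag positive.\<close>
    let ?i = "Suc (k + j)" and ?l = "m + n + Suc (k + j)"
    have \<phi>': "linear_relation R A B \<phi>" "\<alpha> O \<phi> = \<phi> O \<beta>"
      and \<psi>': "linear_relation R B A \<psi>" "\<beta> O \<psi> = \<psi> O \<alpha>"
      using \<phi>(1) \<psi>(1) by (auto simp: intertwiners_def)
    show "shift_equivalent R A \<alpha> B \<beta>"
      unfolding shift_equivalent_def
    proof (intro exI conjI)
      show "linear_relation R A B (\<alpha> ^^ ?i O \<phi>)"
        using linear_relation_relcomp[OF linear_relation_relpow[OF \<alpha> A] \<phi>'(1) A A B] by blast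
      show "linear_relation R B A \<psi>" "\<beta> O \<psi> = \<psi> O \<alpha>" by fact+
      have "\<alpha> O \<alpha> ^^ ?i O \<phi> = \<alpha> ^^ ?i O \<alpha> O \<phi>"
        by (metis O_assoc relpow_commute)
      then show "\<alpha> O \<alpha> ^^ ?i O \<phi> = (\<alpha> ^^ ?i O \<phi>) O \<beta>"
        by (simp only: \<phi>'(2) O_assoc)
      show "0 < ?l" by simp
      have "(\<alpha> ^^ ?i O \<phi>) O \<psi> = \<alpha> ^^ Suc j O \<alpha> ^^ k O \<phi> O \<psi>"
        by (simp only: O_assoc[symmetric] relpow_add[symmetric]) (simp add: add_ac)
      also have "\<dots> = \<alpha> ^^ ?l O Id_on (carrier A)"
        unfolding k[symmetric] by (simp only: O_assoc[symmetric] relpow_add[symmetric]) (simp add: add_ac)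
      finally show "(\<alpha> ^^ ?i O \<phi>) O \<psi> = \<alpha> ^^ ?l" using Id[OF A \<alpha>, of ?l] by simp
      have "\<psi> O \<alpha> ^^ ?i O \<phi> = \<beta> ^^ ?i O \<psi> O \<phi>"
        using relpow_intertwine[OF \<psi>'(2), of ?i] by (metis O_assoc)
      also have "\<dots> = \<beta> ^^ Suc k O \<beta> ^^ j O \<psi> O \<phi>"
        by (simp only: O_assoc[symmetric] relpow_add[symmetric]) (simp add: add_ac)
      also have "\<dots> = \<beta> ^^ ?l O Id_on (carrier B)"
        unfolding j[symmetric] by (simp only: O_assoc[symmetric] relpow_add[symmetric]) (simp add: add_ac)
      finally show "\<psi> O \<alpha> ^^ ?i O \<phi> = \<beta> ^^ ?l" using Id[OF B \<beta>, of ?l] by simp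
    qed
  next
    assume "shift_equivalent R A \<alpha> B \<beta>"
    then obtain \<sigma> \<tau> n where \<sigma>: "\<sigma> \<in> intertwiners R A \<alpha> B \<beta>" and \<tau>: "\<tau> \<in> intertwiners R B \<beta> A \<alpha>"
      and "0 < n" "\<sigma> O \<tau> = \<alpha> ^^ n" "\<tau> O \<sigma> = \<beta> ^^ n"
      unfolding shift_equivalent_def intertwiners_def by blast
    then have "Comp (Szym (FRel R)) (A, \<alpha>) (B, \<beta>) (A, \<alpha>)
        (szym_class (FRel R) (B, \<beta>) (A, \<alpha>) \<tau> n) (szym_class (FRel R) (A, \<alpha>) (B, \<beta>) \<sigma> 0) =
      Ident (Szym (FRel R)) (A, \<alpha>)"
      "Comp (Szym (FRel R)) (B, \<beta>) (A, \<alpha>) (B, \<beta>)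
        (szym_class (FRel R) (A, \<alpha>) (B, \<beta>) \<sigma> 0) (szym_class (FRel R) (B, \<beta>) (A, \<alpha>) \<tau> n) =
      Ident (Szym (FRel R)) (B, \<beta>)"
      by (intro Szym_comp_eq_Ident A B \<alpha> \<beta> \<sigma> \<tau>; simp)+
    moreover have "szym_class (FRel R) (A, \<alpha>) (B, \<beta>) \<sigma> 0 \<in> Hom (Szym (FRel R)) (A, \<alpha>) (B, \<beta>)"
      "szym_class (FRel R) (B, \<beta>) (A, \<alpha>) \<tau> n \<in> Hom (Szym (FRel R)) (B, \<beta>) (A, \<alpha>)"
      using \<sigma> \<tau> by (auto simp: Szym_simps End_FRel_simps szym_class_def intro!: quotientI)
    ultimately show "isomorphic_in (Szym (FRel R)) (A, \<alpha>) (B, \<beta>)"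
      using assms unfolding isomorphic_in_def Szym_simps(1) by blast
  qed
qed

section \<open>Isomorphism of bijective endorelations is shift equivalence\<close>

definition bijective_on :: "'a set \<Rightarrow> ('a \<times> 'a) set \<Rightarrow> bool" where
  "bijective_on C \<alpha> \<longleftrightarrow> \<alpha> O \<alpha>\<inverse> = Id_on C \<and> \<alpha>\<inverse> O \<alpha> = Id_on C"

lemma relpow_relcomp_converse:
  assumes "\<alpha> \<subseteq> C \<times> C" and "\<alpha> O \<alpha>\<inverse> = Id_on C" and "0 < n"
  shows "\<alpha> ^^ n O (\<alpha> ^^ n)\<inverse> = Id_on C"
  using assms(3)
proof (induction n rule: nat_induct_non_zero)
  case 1
  then show ?case using assms by simp
next
  case (Suc n)
  have "\<alpha> ^^ Suc n O (\<alpha> ^^ Suc n)\<inverse> = \<alpha> O (\<alpha> ^^ n O (\<alpha> ^^ n)\<inverse>) O \<alpha>\<inverse>"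
    by (simp only: relpow.simps relpow_commute[symmetric] converse_relcomp O_assoc)
  also have "\<dots> = \<alpha> O \<alpha>\<inverse>" unfolding Suc using assms(1) by auto
  finally show ?case using assms(2) by simp
qed

text \<open>
  Once \<open>\<alpha>\<close> and \<open>\<beta>\<close> are invertible, \<open>\<sigma> O \<tau> = \<alpha> ^^ n\<close> and \<open>\<tau> O \<sigma> = \<beta> ^^ n\<close> provide a right and a left
  inverse of \<open>\<sigma>\<close>, which must coincide.
\<close>

lemma End_isomorphic_iff_shift_equivalent:
  assumes A: "(A, \<alpha>) \<in> Obj (End (FRel R))" and B: "(B, \<beta>) \<in> Obj (End (FRel R))"
    and bij\<alpha>: "bijective_on (carrier A) \<alpha>" and bij\<beta>: "bijective_on (carrier B) \<beta>"
  shows "isomorphic_in (End (FRel R)) (A, \<alpha>) (B, \<beta>) \<longleftrightarrow> shift_equivalent R A \<alpha> B \<beta>"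
proof
  have mod: "module R A" "module R B"
    and \<alpha>: "linear_relation R A A \<alpha>" and \<beta>: "linear_relation R B B \<beta>"
    using A B by (auto simp: End_FRel_simps)
  note \<alpha>_sub = linear_relationD(1)[OF \<alpha> mod(1,1)]
  note \<beta>_sub = linear_relationD(1)[OF \<beta> mod(2,2)]
  {
    assume "isomorphic_in (End (FRel R)) (A, \<alpha>) (B, \<beta>)"
    then obtain f g where f: "linear_relation R A B f" "\<alpha> O f = f O \<beta>"
      and g: "linear_relation R B A g" "\<beta> O g = g O \<alpha>"
      and fg: "f O g = Id_on (carrier A)" "g O f = Id_on (carrier B)"
      by (auto simp: isomorphic_in_def End_FRel_simps intertwiners_def)
    show "shift_equivalent R A \<alpha> B \<beta>"
      unfolding shift_equivalent_def
    proof (intro exI conjI)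
      show "linear_relation R A B (\<alpha> O f)" using linear_relation_relcomp[OF \<alpha> f(1)] mod by blast
      show "linear_relation R B A g" "\<beta> O g = g O \<alpha>" by fact+
      show "\<alpha> O \<alpha> O f = (\<alpha> O f) O \<beta>" by (metis O_assoc f(2))
      show "0 < (1::nat)" by simp
      show "(\<alpha> O f) O g = \<alpha> ^^ 1" using \<alpha>_sub by (simp add: O_assoc fg relcomp_Id_on Id_O_R)
      have "g O \<alpha> O f = (g O f) O \<beta>" by (simp add: f(2) O_assoc)
      then show "g O \<alpha> O f = \<beta> ^^ 1" using \<beta>_sub by (simp add: fg Id_on_relcomp Id_O_R)
    qed
  next
    assume "shift_equivalent R A \<alpha> B \<beta>"
    then obtain \<sigma> \<tau> n where \<sigma>: "linear_relation R A B \<sigma>" "\<alpha> O \<sigma> = \<sigma> O \<beta>"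
      and \<tau>: "linear_relation R B A \<tau>" "\<beta> O \<tau> = \<tau> O \<alpha>"
      and n: "0 < n" "\<sigma> O \<tau> = \<alpha> ^^ n" "\<tau> O \<sigma> = \<beta> ^^ n"
      unfolding shift_equivalent_def by blast
    have \<beta>_sub': "\<beta>\<inverse> \<subseteq> carrier B \<times> carrier B" using \<beta>_sub by blast
    define g where "g = \<tau> O (\<alpha> ^^ n)\<inverse>"
    define h where "h = (\<beta> ^^ n)\<inverse> O \<tau>"
    have pow: "linear_relation R A A (\<alpha> ^^ n)" using linear_relation_relpow[OF \<alpha> mod(1) n(1)] .
    have g: "linear_relation R B A g"
      using linear_relation_relcomp[OF \<tau>(1) linear_relation_converse[OF pow]] mod
      by (simp add: g_def)
    have h: "linear_relation R B A h"
      using linear_relation_relcomp[OF linear_relation_converse \<tau>(1)]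
        linear_relation_relpow[OF \<beta> mod(2) n(1)] mod by (simp add: h_def)
    have \<sigma>g: "\<sigma> O g = Id_on (carrier A)"
      using relpow_relcomp_converse[OF \<alpha>_sub _ n(1)] bij\<alpha>
      by (simp add: g_def n(2) bijective_on_def flip: O_assoc)
    have h\<sigma>: "h O \<sigma> = Id_on (carrier B)"
      using relpow_relcomp_converse[OF \<beta>_sub' _ n(1)] bij\<beta>
      by (simp add: h_def n(3) bijective_on_def O_assoc flip: converse_relpow)
    have "h = h O \<sigma> O g"
      using linear_relationD(1)[OF h mod(2,1)] by (simp add: \<sigma>g relcomp_Id_on)
    also have "\<dots> = g"
      using linear_relationD(1)[OF g mod(2,1)] by (simp add: h\<sigma> Id_on_relcomp flip: O_assoc)
    finally have g\<sigma>: "g O \<sigma> = Id_on (carrier B)" using h\<sigma> by simp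
    have "\<beta> O g = (g O \<sigma>) O \<beta> O g"
      unfolding g\<sigma> using \<beta>_sub by auto
    also have "\<dots> = (g O \<alpha>) O (\<sigma> O g)" by (metis O_assoc \<sigma>(2))
    also have "\<dots> = g O \<alpha>" unfolding \<sigma>g using \<alpha>_sub by auto
    finally show "isomorphic_in (End (FRel R)) (A, \<alpha>) (B, \<beta>)"
      using A B \<sigma> g \<sigma>g g\<sigma>
      unfolding isomorphic_in_def End_FRel_simps intertwiners_def by blast
  }
qed

section \<open>Stabilising powers and the generalised kernel\<close>

text \<open>
  Serves the generalised kernel with \<open>S\<close> the zero submodule and the generalised image with
  \<open>S\<close> the whole module, replacing integer exponents by natural ones for \<open>\<alpha>\<close> and its converse.
\<close>

lemma range_rel_int_pow_Image:
  assumes "S \<subseteq> carrier A"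
  shows "range (\<lambda>l. rel_int_pow R A \<alpha> l `` S) =
    range (\<lambda>n. (\<alpha> ^^ n) `` S) \<union> range (\<lambda>n. ((\<alpha>\<inverse>) ^^ n) `` S)"
proof -
  have *: "endo_pow (Rel R) A \<beta> n `` S = (\<beta> ^^ n) `` S" for \<beta> n
  proof -
    have "endo_pow (Rel R) A \<beta> n = Id_on (carrier A) O \<beta> ^^ n"
      by (induction n) (auto simp: Rel_def O_assoc)
    then show ?thesis using assms by (fastforce simp: relcomp_Image)
  qed
  have nonneg: "rel_int_pow R A \<alpha> (int n) `` S = (\<alpha> ^^ n) `` S" for n
    by (simp add: rel_int_pow_def *)
  moreover have "rel_int_pow R A \<alpha> (- int n) `` S = ((\<alpha>\<inverse>) ^^ n) `` S" for n
  proof (cases n)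
    case 0
    then show ?thesis using nonneg[of 0] by simp
  next
    case (Suc k)
    then show ?thesis
      by (simp add: rel_int_pow_def * del: of_nat_Suc relpow.simps endo_pow.simps)
  qed
  moreover have "\<exists>n. l = int n \<or> l = - int n" for l :: int
    by (metis int_cases2)
  ultimately show ?thesis
    by (auto simp: image_iff) metis+
qed

lemma submodule_Inter:
  assumes "module R M" and "\<And>H. H \<in> \<H> \<Longrightarrow> submodule H R M" and "\<H> \<noteq> {}"
  shows "submodule (\<Inter>\<H>) R M"
  using assms(2,3) unfolding submodule_iff[OF assms(1)] by (intro conjI ballI InterI; blast)

lemma submodule_generated_submodule:
  assumes "module R M" and "S \<subseteq> carrier M"
  shows "submodule (generated_submodule R M S) R M" and "S \<subseteq> generated_submodule R M S"
    and "submodule H R M \<Longrightarrow> S \<subseteq> H \<Longrightarrow> generated_submodule R M S \<subseteq> H"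
  using assms module.carrier_is_submodule[OF assms(1)] unfolding generated_submodule_def
  by (intro submodule_Inter; blast) blast+

lemma submodule_add:
  assumes "module R M" and P: "submodule P R M" and Q: "submodule Q R M"
  shows "submodule {u \<oplus>\<^bsub>M\<^esub> v | u v. u \<in> P \<and> v \<in> Q} R M"
proof -
  interpret module R M by fact
  note P = P[unfolded submodule_iff[OF assms(1)]] and Q = Q[unfolded submodule_iff[OF assms(1)]]
  show ?thesis
    unfolding submodule_iff[OF assms(1)]
  proof (intro conjI ballI)
    show "{u \<oplus>\<^bsub>M\<^esub> v | u v. u \<in> P \<and> v \<in> Q} \<subseteq> carrier M" using P Q by auto
    show "\<zero>\<^bsub>M\<^esub> \<in> {u \<oplus>\<^bsub>M\<^esub> v | u v. u \<in> P \<and> v \<in> Q}"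
      using P Q by (auto intro!: exI[of _ "\<zero>\<^bsub>M\<^esub>"])
    fix x y assume "x \<in> {u \<oplus>\<^bsub>M\<^esub> v | u v. u \<in> P \<and> v \<in> Q}" "y \<in> {u \<oplus>\<^bsub>M\<^esub> v | u v. u \<in> P \<and> v \<in> Q}"
    then obtain u v u' v' where *: "x = u \<oplus>\<^bsub>M\<^esub> v" "y = u' \<oplus>\<^bsub>M\<^esub> v'" "u \<in> P" "u' \<in> P" "v \<in> Q" "v' \<in> Q"
      by blast
    have "x \<oplus>\<^bsub>M\<^esub> y = (u \<oplus>\<^bsub>M\<^esub> u') \<oplus>\<^bsub>M\<^esub> (v \<oplus>\<^bsub>M\<^esub> v')"
      using * P Q by (simp add: subset_iff M.a_ac)
    then show "x \<oplus>\<^bsub>M\<^esub> y \<in> {u \<oplus>\<^bsub>M\<^esub> v | u v. u \<in> P \<and> v \<in> Q}" using * P Q by blast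
  next
    fix r x assume "r \<in> carrier R" "x \<in> {u \<oplus>\<^bsub>M\<^esub> v | u v. u \<in> P \<and> v \<in> Q}"
    then obtain u v where *: "x = u \<oplus>\<^bsub>M\<^esub> v" "u \<in> P" "v \<in> Q" by blast
    then have "r \<odot>\<^bsub>M\<^esub> x = (r \<odot>\<^bsub>M\<^esub> u) \<oplus>\<^bsub>M\<^esub> (r \<odot>\<^bsub>M\<^esub> v)"
      using P Q \<open>r \<in> carrier R\<close> by (simp add: subset_iff smult_r_distr)
    then show "r \<odot>\<^bsub>M\<^esub> x \<in> {u \<oplus>\<^bsub>M\<^esub> v | u v. u \<in> P \<and> v \<in> Q}"
      using * P Q \<open>r \<in> carrier R\<close> by blast
  qed
qed

lemma submodule_relpow_Image:
  assumes "module R A" and "linear_relation R A A \<alpha>" and "submodule H R A"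
  shows "submodule ((\<alpha> ^^ n) `` H) R A"
proof (cases "n = 0")
  case False
  then show ?thesis
    using submodule_Image[OF linear_relation_relpow[OF assms(2,1)] assms(1,1,3)] by simp
qed (simp add: assms(3))

lemma relpow_zero_stable:
  assumes "module R A" and \<alpha>: "linear_relation R A A \<alpha>" and "finite_length R A"
  obtains N where "\<And>n. N \<le> n \<Longrightarrow> (\<alpha> ^^ n) `` {\<zero>\<^bsub>A\<^esub>} = (\<alpha> ^^ N) `` {\<zero>\<^bsub>A\<^esub>}"
proof -
  let ?P = "\<lambda>n. (\<alpha> ^^ n) `` {\<zero>\<^bsub>A\<^esub>}"
  have "?P n \<subseteq> ?P (Suc n)" for n
    using linear_relationD(2)[OF \<alpha> assms(1,1)] by (auto simp del: relpow.simps intro: relpow_Suc_I2)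
  then have "\<exists>N. \<forall>n\<ge>N. ?P n = ?P N"
    using submodule_relpow_Image[OF assms(1) \<alpha> submodule_zero[OF assms(1)]] assms(3)
    unfolding finite_length_def noetherian_module_def by (elim conjE allE[of _ ?P]) blast
  then show ?thesis using that by blast
qed

lemma relpow_carrier_stable:
  assumes "module R A" and \<alpha>: "linear_relation R A A \<alpha>" and "finite_length R A"
  obtains N where "\<And>n. N \<le> n \<Longrightarrow> (\<alpha> ^^ n) `` carrier A = (\<alpha> ^^ N) `` carrier A"
proof -
  let ?D = "\<lambda>n. (\<alpha> ^^ n) `` carrier A"
  have "?D (Suc n) \<subseteq> ?D n" for n
    using linear_relationD(1)[OF \<alpha> assms(1,1)] by (fastforce dest: relpow_Suc_D2)
  then have "\<exists>N. \<forall>n\<ge>N. ?D n = ?D N"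
    using submodule_relpow_Image[OF assms(1) \<alpha> module.carrier_is_submodule[OF assms(1)]] assms(3)
    unfolding finite_length_def artinian_module_def by (elim conjE allE[of _ ?D]) blast
  then show ?thesis using that by blast
qed

lemma
  assumes "module R A" and \<alpha>: "linear_relation R A A \<alpha>"
  shows submodule_gker:
      "submodule (gker R A \<alpha>) R A"
    and relpow_zero_subset_gker:
      "(\<alpha> ^^ n) `` {\<zero>\<^bsub>A\<^esub>} \<subseteq> gker R A \<alpha>"
    and converse_relpow_zero_subset_gker:
      "((\<alpha>\<inverse>) ^^ n) `` {\<zero>\<^bsub>A\<^esub>} \<subseteq> gker R A \<alpha>"
    and gker_least:
      "submodule H R A \<Longrightarrow> (\<And>n. (\<alpha> ^^ n) `` {\<zero>\<^bsub>A\<^esub>} \<subseteq> H) \<Longrightarrow>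
      (\<And>n. ((\<alpha>\<inverse>) ^^ n) `` {\<zero>\<^bsub>A\<^esub>} \<subseteq> H) \<Longrightarrow> gker R A \<alpha> \<subseteq> H"
proof -
  let ?S = "(\<Union>n. (\<alpha> ^^ n) `` {\<zero>\<^bsub>A\<^esub>}) \<union> (\<Union>n. ((\<alpha>\<inverse>) ^^ n) `` {\<zero>\<^bsub>A\<^esub>})"
  have zero: "\<zero>\<^bsub>A\<^esub> \<in> carrier A" using submoduleD(1)[OF assms(1) submodule_zero[OF assms(1)]] by simp
  have gker: "gker R A \<alpha> = generated_submodule R A ?S"
    using range_rel_int_pow_Image[of "{\<zero>\<^bsub>A\<^esub>}" A R \<alpha>] zero by (simp add: gker_def)
  have "(\<beta> ^^ n) `` {\<zero>\<^bsub>A\<^esub>} \<subseteq> carrier A" if "linear_relation R A A \<beta>" for \<beta> n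
    using submodule_relpow_Image[OF assms(1) that submodule_zero[OF assms(1)]]
    by (simp add: submodule_iff[OF assms(1)])
  then have S: "?S \<subseteq> carrier A"
    using \<alpha> linear_relation_converse[OF \<alpha> assms(1,1)] by (intro Un_least UN_least)
  note gen = submodule_generated_submodule[OF assms(1) S, folded gker]
  show "submodule (gker R A \<alpha>) R A" by (fact gen)
  show "(\<alpha> ^^ n) `` {\<zero>\<^bsub>A\<^esub>} \<subseteq> gker R A \<alpha>" "((\<alpha>\<inverse>) ^^ n) `` {\<zero>\<^bsub>A\<^esub>} \<subseteq> gker R A \<alpha>"
    by (intro order_trans[OF _ gen(2)] le_supI1 UN_upper UNIV_I)
      (intro order_trans[OF _ gen(2)] le_supI2 UN_upper UNIV_I)
  show "submodule H R A \<Longrightarrow> (\<And>n. (\<alpha> ^^ n) `` {\<zero>\<^bsub>A\<^esub>} \<subseteq> H) \<Longrightarrow>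
      (\<And>n. ((\<alpha>\<inverse>) ^^ n) `` {\<zero>\<^bsub>A\<^esub>} \<subseteq> H) \<Longrightarrow> gker R A \<alpha> \<subseteq> H"
    by (rule gen(3), assumption, intro Un_least UN_least)
qed

text \<open>
  By the ascending chain condition, \<open>gker\<close> is the sum of two submodules: the points reached from \<open>0\<close> in \<open>N\<close> steps
  and the points reaching \<open>0\<close> in \<open>N\<close> steps. A point \<open>u\<close> of the first kind is reached from \<open>0\<close> in any larger number
  of steps too, so it has predecessors of every order \<open>n\<close> inside the generalised kernel, and \<open>0\<close> is one
  of them as soon as \<open>n\<close> is at least \<open>N\<close>. The second kind is the mirror image.
\<close>

lemma gker_splits:
  assumes A: "module R A" and \<alpha>: "linear_relation R A A \<alpha>" and "finite_length R A"
  obtains N where "0 < N"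
    and "\<And>k n m. k \<in> gker R A \<alpha> \<Longrightarrow> \<exists>u v p q.
      k = u \<oplus>\<^bsub>A\<^esub> v \<and> u \<in> carrier A \<and> v \<in> carrier A \<and>
      (p, u) \<in> \<alpha> ^^ n \<and> p \<in> gker R A \<alpha> \<and> (N \<le> n \<longrightarrow> p = \<zero>\<^bsub>A\<^esub>) \<and>
      (v, q) \<in> \<alpha> ^^ m \<and> q \<in> gker R A \<alpha> \<and> (N \<le> m \<longrightarrow> q = \<zero>\<^bsub>A\<^esub>)"
proof -
  interpret module R A by fact
  have \<alpha>': "linear_relation R A A (\<alpha>\<inverse>)" using linear_relation_converse[OF \<alpha> A A] .
  obtain N1 where N1: "\<And>n. N1 \<le> n \<Longrightarrow> (\<alpha> ^^ n) `` {\<zero>\<^bsub>A\<^esub>} = (\<alpha> ^^ N1) `` {\<zero>\<^bsub>A\<^esub>}"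
    using relpow_zero_stable[OF A \<alpha> assms(3)] by blast
  obtain N2 where N2: "\<And>n. N2 \<le> n \<Longrightarrow> ((\<alpha>\<inverse>) ^^ n) `` {\<zero>\<^bsub>A\<^esub>} = ((\<alpha>\<inverse>) ^^ N2) `` {\<zero>\<^bsub>A\<^esub>}"
    using relpow_zero_stable[OF A \<alpha>' assms(3)] by blast
  \<comment> \<open>One bound for both directions; the successor only makes it positive.\<close>
  define N where "N = Suc (max N1 N2)"
  have backward: "\<exists>p. (p, u) \<in> \<beta> ^^ n \<and> p \<in> (\<beta> ^^ N) `` {\<zero>\<^bsub>A\<^esub>} \<and> (N \<le> n \<longrightarrow> p = \<zero>\<^bsub>A\<^esub>)"
    if stable: "\<And>n. N \<le> n \<Longrightarrow> (\<beta> ^^ n) `` {\<zero>\<^bsub>A\<^esub>} = (\<beta> ^^ N) `` {\<zero>\<^bsub>A\<^esub>}"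
      and \<beta>: "linear_relation R A A \<beta>" and "u \<in> (\<beta> ^^ N) `` {\<zero>\<^bsub>A\<^esub>}" for \<beta> u n
  proof (cases "N \<le> n")
    case True
    have "\<zero>\<^bsub>A\<^esub> \<in> (\<beta> ^^ N) `` {\<zero>\<^bsub>A\<^esub>}"
      by (rule submoduleD(2)[OF A submodule_relpow_Image[OF A \<beta> submodule_zero[OF A]]])
    then show ?thesis using True stable[OF True] that(3) by blast
  next
    case False
    have "u \<in> (\<beta> ^^ (N + n)) `` {\<zero>\<^bsub>A\<^esub>}" using stable[of "N + n"] that(3) by simp
    then show ?thesis using False by (auto simp: relpow_add)
  qed
  have stable1: "(\<alpha> ^^ n) `` {\<zero>\<^bsub>A\<^esub>} = (\<alpha> ^^ N) `` {\<zero>\<^bsub>A\<^esub>}" if "N \<le> n" for n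
    using N1[of n] N1[of N] that by (simp add: N_def)
  have stable2: "((\<alpha>\<inverse>) ^^ n) `` {\<zero>\<^bsub>A\<^esub>} = ((\<alpha>\<inverse>) ^^ N) `` {\<zero>\<^bsub>A\<^esub>}" if "N \<le> n" for n
    using N2[of n] N2[of N] that by (simp add: N_def)
  let ?P = "(\<alpha> ^^ N) `` {\<zero>\<^bsub>A\<^esub>}" and ?Q = "((\<alpha>\<inverse>) ^^ N) `` {\<zero>\<^bsub>A\<^esub>}"
  have P: "submodule ?P R A" and Q: "submodule ?Q R A"
    using submodule_relpow_Image[OF A _ submodule_zero[OF A]] \<alpha> \<alpha>' by blast+
  note P' = P[unfolded submodule_iff[OF A]] and Q' = Q[unfolded submodule_iff[OF A]]
  have mono: "(\<beta> ^^ n) `` {\<zero>\<^bsub>A\<^esub>} \<subseteq> (\<beta> ^^ (N + n)) `` {\<zero>\<^bsub>A\<^esub>}" if \<beta>: "linear_relation R A A \<beta>" for \<beta> n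
    using submoduleD(2)[OF A submodule_relpow_Image[OF A \<beta> submodule_zero[OF A], of N]]
    by (fastforce simp: relpow_add)
  have gker: "gker R A \<alpha> \<subseteq> {u \<oplus>\<^bsub>A\<^esub> v | u v. u \<in> ?P \<and> v \<in> ?Q}"
  proof (rule gker_least[OF A \<alpha> submodule_add[OF A P Q]])
    fix n
    have "(\<alpha> ^^ n) `` {\<zero>\<^bsub>A\<^esub>} \<subseteq> ?P" using mono[OF \<alpha>, of n] stable1[of "N + n"] by simp
    moreover have "x = x \<oplus>\<^bsub>A\<^esub> \<zero>\<^bsub>A\<^esub>" if "x \<in> ?P" for x using P' that by (simp add: subset_iff)
    ultimately show "(\<alpha> ^^ n) `` {\<zero>\<^bsub>A\<^esub>} \<subseteq> {u \<oplus>\<^bsub>A\<^esub> v | u v. u \<in> ?P \<and> v \<in> ?Q}" using Q' by blast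
    have "((\<alpha>\<inverse>) ^^ n) `` {\<zero>\<^bsub>A\<^esub>} \<subseteq> ?Q" using mono[OF \<alpha>', of n] stable2[of "N + n"] by simp
    moreover have "x = \<zero>\<^bsub>A\<^esub> \<oplus>\<^bsub>A\<^esub> x" if "x \<in> ?Q" for x using Q' that by (simp add: subset_iff)
    ultimately show "((\<alpha>\<inverse>) ^^ n) `` {\<zero>\<^bsub>A\<^esub>} \<subseteq> {u \<oplus>\<^bsub>A\<^esub> v | u v. u \<in> ?P \<and> v \<in> ?Q}" using P' by blast
  qed
  show ?thesis
  proof (rule that)
    show "0 < N" by (simp add: N_def)
    fix k n m assume "k \<in> gker R A \<alpha>"
    then obtain u v where k: "k = u \<oplus>\<^bsub>A\<^esub> v" and u: "u \<in> ?P" and v: "v \<in> ?Q" using gker by blast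
    obtain p where p: "(p, u) \<in> \<alpha> ^^ n" "p \<in> ?P" "N \<le> n \<longrightarrow> p = \<zero>\<^bsub>A\<^esub>"
      using backward[OF stable1 \<alpha> u] by blast
    obtain q where q: "(q, v) \<in> (\<alpha>\<inverse>) ^^ m" "q \<in> ?Q" "N \<le> m \<longrightarrow> q = \<zero>\<^bsub>A\<^esub>"
      using backward[OF stable2 \<alpha>' v] by blast
    have "(v, q) \<in> \<alpha> ^^ m" using q(1) by (simp flip: converse_relpow)
    moreover have "p \<in> gker R A \<alpha>" "q \<in> gker R A \<alpha>"
      using p(2) q(2) relpow_zero_subset_gker[OF A \<alpha>]
        converse_relpow_zero_subset_gker[OF A \<alpha>] by (meson subsetD)+
    moreover have "u \<in> carrier A" "v \<in> carrier A"
      using u v submoduleD(1)[OF A P] submoduleD(1)[OF A Q] by (meson subsetD)+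
    ultimately show "\<exists>u v p q.
      k = u \<oplus>\<^bsub>A\<^esub> v \<and> u \<in> carrier A \<and> v \<in> carrier A \<and>
      (p, u) \<in> \<alpha> ^^ n \<and> p \<in> gker R A \<alpha> \<and> (N \<le> n \<longrightarrow> p = \<zero>\<^bsub>A\<^esub>) \<and>
      (v, q) \<in> \<alpha> ^^ m \<and> q \<in> gker R A \<alpha> \<and> (N \<le> m \<longrightarrow> q = \<zero>\<^bsub>A\<^esub>)"
      using k p(1,3) q(3) by (intro exI[of _ u] exI[of _ v] exI[of _ p] exI[of _ q]) simp
  qed
qed

section \<open>Dividing by the generalised kernel\<close>

lemma a_rcos_eq_iff:
  assumes "module R A" and "submodule K R A" and "x \<in> carrier A" and "y \<in> carrier A"
  shows "K +>\<^bsub>A\<^esub> x = K +>\<^bsub>A\<^esub> y \<longleftrightarrow> y \<ominus>\<^bsub>A\<^esub> x \<in> K"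
proof -
  interpret module R A by fact
  interpret abelian_subgroup K A
    using submodule.axioms(1)[OF assms(2)] by (intro abelian_subgroupI3 additive_subgroupI M.abelian_group_axioms)
  show ?thesis
    using assms(3,4) a_rcos_module a_repr_independence' a_repr_independenceD
    unfolding a_minus_def by metis
qed

lemma quot_module_simps:
  assumes "module R A" and "submodule K R A"
  shows "carrier (quot_module A K) = {K +>\<^bsub>A\<^esub> x | x. x \<in> carrier A}"
    and "\<zero>\<^bsub>quot_module A K\<^esub> = K +>\<^bsub>A\<^esub> \<zero>\<^bsub>A\<^esub>"
    and "x \<in> carrier A \<Longrightarrow> y \<in> carrier A \<Longrightarrow>
      (K +>\<^bsub>A\<^esub> x) \<oplus>\<^bsub>quot_module A K\<^esub> (K +>\<^bsub>A\<^esub> y) = K +>\<^bsub>A\<^esub> (x \<oplus>\<^bsub>A\<^esub> y)"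
    and "r \<in> carrier R \<Longrightarrow> x \<in> carrier A \<Longrightarrow>
      r \<odot>\<^bsub>quot_module A K\<^esub> (K +>\<^bsub>A\<^esub> x) = K +>\<^bsub>A\<^esub> (r \<odot>\<^bsub>A\<^esub> x)"
proof -
  interpret module R A by fact
  interpret abelian_subgroup K A
    using submodule.axioms(1)[OF assms(2)]
    by (intro abelian_subgroupI3 additive_subgroupI M.abelian_group_axioms)
  show "carrier (quot_module A K) = {K +>\<^bsub>A\<^esub> x | x. x \<in> carrier A}"
    by (auto simp: quot_module_def A_RCOSETS_def')
  show "\<zero>\<^bsub>quot_module A K\<^esub> = K +>\<^bsub>A\<^esub> \<zero>\<^bsub>A\<^esub>"
    using a_subset by (simp add: quot_module_def)
  show "x \<in> carrier A \<Longrightarrow> y \<in> carrier A \<Longrightarrow>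
      (K +>\<^bsub>A\<^esub> x) \<oplus>\<^bsub>quot_module A K\<^esub> (K +>\<^bsub>A\<^esub> y) = K +>\<^bsub>A\<^esub> (x \<oplus>\<^bsub>A\<^esub> y)"
    by (simp add: quot_module_def a_rcos_sum)
  assume r: "r \<in> carrier R" and x: "x \<in> carrier A"
  have "K +>\<^bsub>A\<^esub> (r \<odot>\<^bsub>A\<^esub> y) = K +>\<^bsub>A\<^esub> (r \<odot>\<^bsub>A\<^esub> x)" if "y \<in> K +>\<^bsub>A\<^esub> x" for y
  proof -
    have y: "y \<in> carrier A" using a_elemrcos_carrier x that by blast
    have "y \<ominus>\<^bsub>A\<^esub> x \<in> K" using a_rcos_module x y that by (simp add: a_minus_def)
    then have "r \<odot>\<^bsub>A\<^esub> (y \<ominus>\<^bsub>A\<^esub> x) \<in> K" using r submodule.smult_closed[OF assms(2)] by blast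
    then have "(r \<odot>\<^bsub>A\<^esub> y) \<ominus>\<^bsub>A\<^esub> (r \<odot>\<^bsub>A\<^esub> x) \<in> K"
      using r x y by (simp add: a_minus_def smult_r_distr smult_r_minus)
    then show ?thesis using a_rcos_eq_iff[OF assms, of "r \<odot>\<^bsub>A\<^esub> x" "r \<odot>\<^bsub>A\<^esub> y"] r x y by simp
  qed
  then have "(\<Union>y\<in>K +>\<^bsub>A\<^esub> x. K +>\<^bsub>A\<^esub> (r \<odot>\<^bsub>A\<^esub> y)) = (\<Union>y\<in>K +>\<^bsub>A\<^esub> x. K +>\<^bsub>A\<^esub> (r \<odot>\<^bsub>A\<^esub> x))"
    by (intro SUP_cong refl)
  then show "r \<odot>\<^bsub>quot_module A K\<^esub> (K +>\<^bsub>A\<^esub> x) = K +>\<^bsub>A\<^esub> (r \<odot>\<^bsub>A\<^esub> x)"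
    using a_rcos_self[OF x] by (simp add: quot_module_def) blast
qed

lemma module_quot_module:
  assumes "module R A" and "submodule K R A"
  shows "module R (quot_module A K)"
proof -
  interpret module R A by fact
  note simps = quot_module_simps[OF assms]
  show ?thesis
  proof (rule moduleI)
    show "cring R" by (rule is_cring)
    show "abelian_group (quot_module A K)"
    proof (rule abelian_groupI)
      fix X assume "X \<in> carrier (quot_module A K)"
      then obtain x where x: "x \<in> carrier A" "X = K +>\<^bsub>A\<^esub> x" by (auto simp: simps)
      show "\<exists>Y\<in>carrier (quot_module A K). Y \<oplus>\<^bsub>quot_module A K\<^esub> X = \<zero>\<^bsub>quot_module A K\<^esub>"
        using x by (intro bexI[of _ "K +>\<^bsub>A\<^esub> (\<ominus>\<^bsub>A\<^esub> x)"]) (auto simp: simps M.l_neg)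
    qed (auto simp: simps M.a_ac)
  qed (auto simp: simps smult_l_distr smult_r_distr smult_assoc1)
qed

lemma
  assumes A: "module R A" and K: "submodule K R A"
  shows linear_relation_proj_rel:
      "linear_relation R A (quot_module A K) (proj_rel A K)"
    and proj_rel_onto:
      "(proj_rel A K)\<inverse> O proj_rel A K = Id_on (carrier (quot_module A K))"
    and proj_rel_equiv_iff:
      "(x, y) \<in> proj_rel A K O (proj_rel A K)\<inverse> \<longleftrightarrow>
      x \<in> carrier A \<and> y \<in> carrier A \<and> y \<ominus>\<^bsub>A\<^esub> x \<in> K"
proof -
  interpret module R A by fact
  note simps = quot_module_simps[OF assms]
  show "linear_relation R A (quot_module A K) (proj_rel A K)"
    by (rule linear_relationI[OF A module_quot_module[OF assms]])
      (auto simp: proj_rel_def simps)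
  show "(proj_rel A K)\<inverse> O proj_rel A K = Id_on (carrier (quot_module A K))"
    by (auto simp: proj_rel_def simps)
  show "(x, y) \<in> proj_rel A K O (proj_rel A K)\<inverse> \<longleftrightarrow>
      x \<in> carrier A \<and> y \<in> carrier A \<and> y \<ominus>\<^bsub>A\<^esub> x \<in> K"
    using a_rcos_eq_iff[OF assms, of x y] by (auto simp: proj_rel_def)
qed

text \<open>
  A path in the quotient lifts to paths in \<open>A\<close> with jumps by elements \<open>k\<close> of the generalised kernel.
  Splitting \<open>k = u + v\<close>, a jump is repaired by adding to the path before it a path ending in \<open>u\<close>, and
  subtracting from the path after it a path beginning in \<open>v\<close>. This changes the end points
  only within the kernel, and not at all when they are at least \<open>N\<close> steps away, which is the gluing
  property. Applied to paths that begin or end with zeros, it also shows that on the quotient zero is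
  related to zero only.
\<close>

lemma
  assumes A: "module R A" and \<alpha>: "linear_relation R A A \<alpha>" and fin: "finite_length R A"
    and LM: "LM R (A, \<alpha>) = (Q, \<beta>)"
  shows module_LM:
      "module R Q"
    and linear_relation_LM:
      "linear_relation R Q Q \<beta>"
    and finite_length_LM:
      "finite_length R Q"
    and shift_equivalent_LM:
      "shift_equivalent R A \<alpha> Q \<beta>"
    and LM_image_zero:
      "(\<zero>\<^bsub>Q\<^esub>, y) \<in> \<beta> \<Longrightarrow> y = \<zero>\<^bsub>Q\<^esub>"
    and LM_preimage_zero:
      "(y, \<zero>\<^bsub>Q\<^esub>) \<in> \<beta> \<Longrightarrow> y = \<zero>\<^bsub>Q\<^esub>"
proof -
  interpret module R A by fact
  define K where "K = gker R A \<alpha>"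
  define \<pi> where "\<pi> = proj_rel A K"
  have Q_def: "Q = quot_module A K" and \<beta>_def: "\<beta> = \<pi>\<inverse> O \<alpha> O \<pi>"
    using LM by (simp_all add: LM_def Let_def K_def \<pi>_def)
  have K: "submodule K R A" unfolding K_def by (rule submodule_gker[OF A \<alpha>])
  note K' = K[unfolded submodule_iff[OF A]]
  have K_inv: "\<ominus>\<^bsub>A\<^esub> k \<in> K" if "k \<in> K" for k using submoduleE(3)[OF K that] .
  show Q: "module R Q" unfolding Q_def by (rule module_quot_module[OF A K])
  have \<pi>: "linear_relation R A Q \<pi>" unfolding Q_def \<pi>_def by (rule linear_relation_proj_rel[OF A K])
  have onto: "\<pi>\<inverse> O \<pi> = Id_on (carrier Q)" unfolding Q_def \<pi>_def by (rule proj_rel_onto[OF A K])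
  show \<beta>: "linear_relation R Q Q \<beta>"
    unfolding \<beta>_def by (intro linear_relation_relcomp[OF _ _ Q A Q] linear_relation_relcomp[OF _ _ A A Q]
        linear_relation_converse[OF \<pi> A Q] \<alpha> \<pi>)
  show "finite_length R Q" by (rule finite_length_subquotient[OF \<pi> A Q onto fin])
  obtain N where "0 < N" and splits: "\<And>k n m. k \<in> K \<Longrightarrow> \<exists>u v p q.
      k = u \<oplus>\<^bsub>A\<^esub> v \<and> u \<in> carrier A \<and> v \<in> carrier A \<and>
      (p, u) \<in> \<alpha> ^^ n \<and> p \<in> K \<and> (N \<le> n \<longrightarrow> p = \<zero>\<^bsub>A\<^esub>) \<and>
      (v, q) \<in> \<alpha> ^^ m \<and> q \<in> K \<and> (N \<le> m \<longrightarrow> q = \<zero>\<^bsub>A\<^esub>)"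
    using gker_splits[OF A \<alpha> fin] unfolding K_def by blast
  let ?E = "\<pi> O \<pi>\<inverse>" and ?P = "collar N \<pi>"
  have E_iff: "(x, y) \<in> ?E \<longleftrightarrow> x \<in> carrier A \<and> y \<in> carrier A \<and> y \<ominus>\<^bsub>A\<^esub> x \<in> K" for x y
    unfolding \<pi>_def by (rule proj_rel_equiv_iff[OF A K])
  have sv: "X = Y" if "(x, X) \<in> \<pi>" "(x, Y) \<in> \<pi>" for x X Y
    using that by (auto simp: \<pi>_def proj_rel_def)
  have E_trans: "(x, z) \<in> ?P n" if "(x, y) \<in> ?P n" "(y, z) \<in> ?P n" for x y z n
    using that sv unfolding collar_def by (cases "N \<le> n") (simp_all, blast)
  have glue1: "\<exists>x' z'. (x, x') \<in> ?P n \<and> (x', z') \<in> \<alpha> ^^ (n + m) \<and> (z', z) \<in> ?P m"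
    if n: "0 < n" and m: "0 < m" and xy: "(x, y) \<in> \<alpha> ^^ n" and yy': "(y, y') \<in> ?E" and yz: "(y', z) \<in> \<alpha> ^^ m"
    for n m x y y' z
  proof -
    note \<alpha>n = linear_relation_relpow[OF \<alpha> A n] and \<alpha>m = linear_relation_relpow[OF \<alpha> A m]
    have carr: "x \<in> carrier A" "y \<in> carrier A" "y' \<in> carrier A" "z \<in> carrier A"
      using xy yz linear_relationD(1)[OF \<alpha>n A A] linear_relationD(1)[OF \<alpha>m A A] by auto
    \<comment> \<open>Repair the jump from \<open>y\<close> to \<open>y'\<close>: both repaired halves pass through \<open>y + u = y' - v\<close>.\<close>
    obtain u v p q where k: "y' \<ominus>\<^bsub>A\<^esub> y = u \<oplus>\<^bsub>A\<^esub> v" and uv: "u \<in> carrier A" "v \<in> carrier A"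
      and p: "(p, u) \<in> \<alpha> ^^ n" "p \<in> K" "N \<le> n \<longrightarrow> p = \<zero>\<^bsub>A\<^esub>"
      and q: "(v, q) \<in> \<alpha> ^^ m" "q \<in> K" "N \<le> m \<longrightarrow> q = \<zero>\<^bsub>A\<^esub>"
      using splits[of "y' \<ominus>\<^bsub>A\<^esub> y" n m] yy' unfolding E_iff by blast
    have pq: "p \<in> carrier A" "q \<in> carrier A" using p(2) q(2) K' by auto
    have "y' = (y' \<ominus>\<^bsub>A\<^esub> y) \<oplus>\<^bsub>A\<^esub> y" using carr by (simp add: M.minus_eq M.a_assoc M.l_neg)
    then have "y' = (y \<oplus>\<^bsub>A\<^esub> u) \<oplus>\<^bsub>A\<^esub> v" unfolding k using carr uv by (simp add: M.a_ac)
    then have "y \<oplus>\<^bsub>A\<^esub> u = y' \<ominus>\<^bsub>A\<^esub> v" using carr uv by (simp add: M.minus_eq M.a_assoc M.r_neg)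
    moreover have "(x \<oplus>\<^bsub>A\<^esub> p, y \<oplus>\<^bsub>A\<^esub> u) \<in> \<alpha> ^^ n" by (rule linear_relationD(3)[OF \<alpha>n A A xy p(1)])
    moreover have "(y' \<ominus>\<^bsub>A\<^esub> v, z \<ominus>\<^bsub>A\<^esub> q) \<in> \<alpha> ^^ m" by (rule linear_relationD(5)[OF \<alpha>m A A yz q(1)])
    ultimately have "(x \<oplus>\<^bsub>A\<^esub> p, z \<ominus>\<^bsub>A\<^esub> q) \<in> \<alpha> ^^ (n + m)" by (auto intro: relpow_trans)
    moreover have "(x \<oplus>\<^bsub>A\<^esub> p) \<ominus>\<^bsub>A\<^esub> x = p" using carr pq by (simp add: M.minus_eq M.a_ac M.r_neg1 M.r_neg2 M.l_neg M.r_neg)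
    then have "(x, x \<oplus>\<^bsub>A\<^esub> p) \<in> ?P n"
      using p carr pq E_iff[of x "x \<oplus>\<^bsub>A\<^esub> p"] by (auto simp: collar_def)
    moreover have "z \<ominus>\<^bsub>A\<^esub> (z \<ominus>\<^bsub>A\<^esub> q) = q" using carr pq by (simp add: M.minus_eq M.minus_add M.r_neg1 M.r_neg2)
    then have "(z \<ominus>\<^bsub>A\<^esub> q, z) \<in> ?P m"
      using q carr pq E_iff[of "z \<ominus>\<^bsub>A\<^esub> q" z] by (auto simp: collar_def M.minus_eq)
    ultimately show ?thesis by blast
  qed
  have glue: "?P n O \<alpha> ^^ n O ?E O \<alpha> ^^ m O ?P m = ?P n O \<alpha> ^^ (n + m) O ?P m"
    if n: "0 < n" and m: "0 < m" for n m
  proof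
    show "?P n O \<alpha> ^^ n O ?E O \<alpha> ^^ m O ?P m \<subseteq> ?P n O \<alpha> ^^ (n + m) O ?P m"
      by (blast dest: glue1[OF n m] intro: E_trans)
    have "(y, y) \<in> ?E" if "(x, y) \<in> \<alpha> ^^ n" for x y
      using that linear_relationD(1)[OF linear_relation_relpow[OF \<alpha> A n] A A]
      by (auto simp: \<pi>_def proj_rel_def)
    then show "?P n O \<alpha> ^^ (n + m) O ?P m \<subseteq> ?P n O \<alpha> ^^ n O ?E O \<alpha> ^^ m O ?P m"
      unfolding relpow_add by blast
  qed
  show "shift_equivalent R A \<alpha> Q \<beta>"
    unfolding \<beta>_def by (rule shift_equivalent_subquotient[OF A Q \<alpha> \<pi> onto \<open>0 < N\<close> glue])
  have zero: "\<zero>\<^bsub>Q\<^esub> = K +>\<^bsub>A\<^esub> \<zero>\<^bsub>A\<^esub>" unfolding Q_def by (rule quot_module_simps(2)[OF A K])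
  have zero_N: "(\<zero>\<^bsub>A\<^esub>, \<zero>\<^bsub>A\<^esub>) \<in> \<alpha> ^^ N"
    by (rule linear_relationD(2)[OF linear_relation_relpow[OF \<alpha> A \<open>0 < N\<close>] A A])
  have \<pi>_zero: "(k, \<zero>\<^bsub>Q\<^esub>) \<in> \<pi> \<longleftrightarrow> k \<in> K" for k
  proof -
    have "k \<ominus>\<^bsub>A\<^esub> \<zero>\<^bsub>A\<^esub> = k" if "k \<in> carrier A"
      using that by (simp add: M.minus_eq M.add.inv_one)
    moreover have "(k, \<zero>\<^bsub>Q\<^esub>) \<in> \<pi> \<longleftrightarrow> k \<in> carrier A \<and> K +>\<^bsub>A\<^esub> \<zero>\<^bsub>A\<^esub> = K +>\<^bsub>A\<^esub> k"
      by (auto simp: zero \<pi>_def proj_rel_def)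
    ultimately show ?thesis
      using a_rcos_eq_iff[OF A K, of "\<zero>\<^bsub>A\<^esub>" k] submoduleD(1)[OF A K] by auto
  qed
  have \<pi>_zero_zero: "(\<zero>\<^bsub>A\<^esub>, \<zero>\<^bsub>Q\<^esub>) \<in> \<pi>" by (rule linear_relationD(2)[OF \<pi> A Q])
  show "y = \<zero>\<^bsub>Q\<^esub>" if zero_y: "(\<zero>\<^bsub>Q\<^esub>, y) \<in> \<beta>"
  proof -
    obtain k c where k: "(k, \<zero>\<^bsub>Q\<^esub>) \<in> \<pi>" "(k, c) \<in> \<alpha>" "(c, y) \<in> \<pi>"
      using zero_y unfolding \<beta>_def by blast
    have "(\<zero>\<^bsub>A\<^esub>, k) \<in> ?E" using k(1) \<pi>_zero_zero by blast
    \<comment> \<open>Prefixing \<open>N\<close> zeros keeps the start of the glued path at zero.\<close>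
    then obtain x' z' where *: "(\<zero>\<^bsub>A\<^esub>, x') \<in> ?P N" "(x', z') \<in> \<alpha> ^^ (N + 1)" "(z', c) \<in> ?P 1"
      using glue1[OF \<open>0 < N\<close> _ zero_N _ , of 1 k c] k(2) by auto
    then have "z' \<in> K" using relpow_zero_subset_gker[OF A \<alpha>, of "N + 1"] by (auto simp: K_def collar_def)
    then have "(z', \<zero>\<^bsub>Q\<^esub>) \<in> \<pi>" by (simp add: \<pi>_zero)
    moreover have "(z', y) \<in> \<pi>"
      using *(3) k(3) sv by (auto simp: collar_def split: if_splits)
    ultimately show ?thesis using sv by blast
  qed
  show "y = \<zero>\<^bsub>Q\<^esub>" if y_zero: "(y, \<zero>\<^bsub>Q\<^esub>) \<in> \<beta>"
  proof -
    obtain k c where k: "(k, \<zero>\<^bsub>Q\<^esub>) \<in> \<pi>" "(c, k) \<in> \<alpha>" "(c, y) \<in> \<pi>"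
      using y_zero unfolding \<beta>_def by blast
    have "(k, \<zero>\<^bsub>A\<^esub>) \<in> ?E" using k(1) \<pi>_zero_zero by blast
    then obtain x' z' where *: "(c, x') \<in> ?P 1" "(x', z') \<in> \<alpha> ^^ (1 + N)" "(z', \<zero>\<^bsub>A\<^esub>) \<in> ?P N"
      using glue1[of 1 N c k "\<zero>\<^bsub>A\<^esub>" "\<zero>\<^bsub>A\<^esub>"] \<open>0 < N\<close> zero_N k(2) by auto
    then have "(\<zero>\<^bsub>A\<^esub>, x') \<in> (\<alpha>\<inverse>) ^^ (1 + N)"
      unfolding converse_relpow[symmetric] by (simp add: collar_def)
    then have "x' \<in> K" using converse_relpow_zero_subset_gker[OF A \<alpha>, of "1 + N"] unfolding K_def by blast
    then have "(x', \<zero>\<^bsub>Q\<^esub>) \<in> \<pi>" by (simp add: \<pi>_zero)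
    moreover have "(x', y) \<in> \<pi>"
      using *(1) k(3) sv by (auto simp: collar_def split: if_splits)
    ultimately show ?thesis using sv by blast
  qed
qed

section \<open>Restricting to the generalised image\<close>

lemma
  assumes A: "module R A" and \<alpha>: "linear_relation R A A \<alpha>"
  shows submodule_gim:
      "submodule (gim R A \<alpha>) R A"
    and in_gim_iff:
      "x \<in> gim R A \<alpha> \<longleftrightarrow> (\<forall>n. x \<in> (\<alpha> ^^ n) `` carrier A \<and> x \<in> ((\<alpha>\<inverse>) ^^ n) `` carrier A)"
proof -
  have gim: "gim R A \<alpha> = \<Inter> (range (\<lambda>n. (\<alpha> ^^ n) `` carrier A) \<union> range (\<lambda>n. ((\<alpha>\<inverse>) ^^ n) `` carrier A))"
    unfolding gim_def range_rel_int_pow_Image[OF subset_refl] ..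
  show "x \<in> gim R A \<alpha> \<longleftrightarrow> (\<forall>n. x \<in> (\<alpha> ^^ n) `` carrier A \<and> x \<in> ((\<alpha>\<inverse>) ^^ n) `` carrier A)"
    unfolding gim by (simp only: Inter_Un_distrib Int_iff INT_iff ball_UNIV all_conj_distrib)
  have "submodule ((\<beta> ^^ n) `` carrier A) R A" if "linear_relation R A A \<beta>" for \<beta> n
    by (rule submodule_relpow_Image[OF A that module.carrier_is_submodule[OF A]])
  then show "submodule (gim R A \<alpha>) R A"
    unfolding gim using \<alpha> linear_relation_converse[OF \<alpha> A A]
    by (intro submodule_Inter[OF A]) auto
qed

text \<open>
  By the descending chain condition, a point with \<open>N\<close> steps behind it has arbitrarily many, and a
  point with \<open>N\<close> steps ahead of it has arbitrarily many. Both properties are also inherited along a path, from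
  its start and from its end, respectively.
\<close>

lemma gim_between:
  assumes A: "module R A" and \<alpha>: "linear_relation R A A \<alpha>" and fin: "finite_length R A"
  obtains N where "0 < N"
    and "\<And>x y z n m. (x, y) \<in> \<alpha> ^^ n \<Longrightarrow> (y, z) \<in> \<alpha> ^^ m \<Longrightarrow> x \<in> carrier A \<Longrightarrow> z \<in> carrier A \<Longrightarrow>
      N \<le> n \<or> x \<in> gim R A \<alpha> \<Longrightarrow> N \<le> m \<or> z \<in> gim R A \<alpha> \<Longrightarrow> y \<in> gim R A \<alpha>"
proof -
  have \<alpha>': "linear_relation R A A (\<alpha>\<inverse>)" using linear_relation_converse[OF \<alpha> A A] .
  obtain N1 where N1: "\<And>n. N1 \<le> n \<Longrightarrow> (\<alpha> ^^ n) `` carrier A = (\<alpha> ^^ N1) `` carrier A"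
    using relpow_carrier_stable[OF A \<alpha> fin] by blast
  obtain N2 where N2: "\<And>n. N2 \<le> n \<Longrightarrow> ((\<alpha>\<inverse>) ^^ n) `` carrier A = ((\<alpha>\<inverse>) ^^ N2) `` carrier A"
    using relpow_carrier_stable[OF A \<alpha>' fin] by blast
  define N where "N = Suc (max N1 N2)"
  have decreasing: "(\<beta> ^^ n) `` carrier A \<subseteq> (\<beta> ^^ m) `` carrier A"
    if "linear_relation R A A \<beta>" "m \<le> n" for \<beta> n m
  proof -
    have "(\<beta> ^^ (n - m)) `` carrier A \<subseteq> carrier A"
      by (rule submoduleD(1)[OF A submodule_relpow_Image[OF A that(1) module.carrier_is_submodule[OF A]]])
    moreover have "\<beta> ^^ n = \<beta> ^^ (n - m) O \<beta> ^^ m" using that(2) by (simp flip: relpow_add)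
    ultimately show ?thesis by (auto simp: relcomp_Image)
  qed
  have reach: "y \<in> (\<beta> ^^ i) `` carrier A"
    if \<beta>: "linear_relation R A A \<beta>"
      and stable: "\<And>n. N \<le> n \<Longrightarrow> (\<beta> ^^ n) `` carrier A = (\<beta> ^^ N) `` carrier A"
      and xy: "(x, y) \<in> \<beta> ^^ n" and x: "x \<in> carrier A"
      and "N \<le> n \<or> (\<forall>i. x \<in> (\<beta> ^^ i) `` carrier A)" for \<beta> x y n i
    using that(5)
  proof
    assume "N \<le> n"
    have "y \<in> (\<beta> ^^ (N + i)) `` carrier A"
      using xy x stable[OF \<open>N \<le> n\<close>] stable[of "N + i"] by auto
    then show ?thesis using decreasing[OF \<beta>, of i "N + i"] by auto
  next
    assume "\<forall>i. x \<in> (\<beta> ^^ i) `` carrier A"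
    then have "y \<in> (\<beta> ^^ (i + n)) `` carrier A" using xy by (auto simp: relpow_add relcomp_Image)
    then show ?thesis using decreasing[OF \<beta>, of i "i + n"] by auto
  qed
  have stable1: "(\<alpha> ^^ n) `` carrier A = (\<alpha> ^^ N) `` carrier A" if "N \<le> n" for n
    using N1[of n] N1[of N] that by (simp add: N_def)
  have stable2: "((\<alpha>\<inverse>) ^^ n) `` carrier A = ((\<alpha>\<inverse>) ^^ N) `` carrier A" if "N \<le> n" for n
    using N2[of n] N2[of N] that by (simp add: N_def)
  show ?thesis
  proof (rule that)
    show "0 < N" by (simp add: N_def)
    fix x y z n m
    assume xy: "(x, y) \<in> \<alpha> ^^ n" and yz: "(y, z) \<in> \<alpha> ^^ m" and "x \<in> carrier A" "z \<in> carrier A"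
      and "N \<le> n \<or> x \<in> gim R A \<alpha>" "N \<le> m \<or> z \<in> gim R A \<alpha>"
    moreover have "(z, y) \<in> (\<alpha>\<inverse>) ^^ m" using yz by (simp flip: converse_relpow)
    ultimately show "y \<in> gim R A \<alpha>"
      using reach[OF \<alpha> stable1 xy] reach[OF \<alpha>' stable2]
      unfolding in_gim_iff[OF A \<alpha>] by blast
  qed
qed

text \<open>
  A path stays in the generalised image if each of its ends either lies in the generalised image or is at least
  \<open>N\<close> steps away; this is the gluing property. It also provides every point of the generalised
  image with a successor and a predecessor there. So if zero is related to zero only, which for a linear relation
  means that it is single-valued and injective, then the relation restricts to a bijection.
\<close>

lemma
  assumes A: "module R A" and \<alpha>: "linear_relation R A A \<alpha>" and fin: "finite_length R A"
    and LE: "LE R (A, \<alpha>) = (I, \<beta>)"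
  shows module_LE:
      "module R I"
    and linear_relation_LE:
      "linear_relation R I I \<beta>"
    and finite_length_LE:
      "finite_length R I"
    and shift_equivalent_LE:
      "shift_equivalent R A \<alpha> I \<beta>"
    and bijective_LE:
      "(\<And>y. (\<zero>\<^bsub>A\<^esub>, y) \<in> \<alpha> \<Longrightarrow> y = \<zero>\<^bsub>A\<^esub>) \<Longrightarrow> (\<And>y. (y, \<zero>\<^bsub>A\<^esub>) \<in> \<alpha> \<Longrightarrow> y = \<zero>\<^bsub>A\<^esub>) \<Longrightarrow>
      bijective_on (carrier I) \<beta>"
proof -
  interpret module R A by fact
  define J where "J = gim R A \<alpha>"
  have I_def: "I = A\<lparr>carrier := J\<rparr>" and \<beta>_def: "\<beta> = (Id_on J)\<inverse> O \<alpha> O Id_on J"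
    using LE by (auto simp: LE_def Let_def J_def incl_rel_def Id_on_def)
  have J: "submodule J R A" unfolding J_def by (rule submodule_gim[OF A \<alpha>])
  note J' = J[unfolded submodule_iff[OF A]]
  show I: "module R I" unfolding I_def by (rule submodule.submodule_is_module[OF J A])
  have \<rho>: "linear_relation R A I (Id_on J)"
    by (rule linear_relationI[OF A I]) (use J' in \<open>auto simp: I_def\<close>)
  have onto: "(Id_on J)\<inverse> O Id_on J = Id_on (carrier I)" by (auto simp: I_def)
  show \<beta>: "linear_relation R I I \<beta>"
    unfolding \<beta>_def by (intro linear_relation_relcomp[OF _ _ I A I] linear_relation_relcomp[OF _ _ A A I]
        linear_relation_converse[OF \<rho> A I] \<alpha> \<rho>)
  show "finite_length R I" by (rule finite_length_subquotient[OF \<rho> A I onto fin])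
  obtain N where "0 < N" and between: "\<And>x y z n m. (x, y) \<in> \<alpha> ^^ n \<Longrightarrow> (y, z) \<in> \<alpha> ^^ m \<Longrightarrow>
      x \<in> carrier A \<Longrightarrow> z \<in> carrier A \<Longrightarrow> N \<le> n \<or> x \<in> J \<Longrightarrow> N \<le> m \<or> z \<in> J \<Longrightarrow> y \<in> J"
    using gim_between[OF A \<alpha> fin] unfolding J_def by blast
  let ?P = "collar N (Id_on J)"
  have P: "?P i = (if N \<le> i then Id else Id_on J)" for i by (auto simp: collar_def)
  have glue: "?P n O \<alpha> ^^ n O (Id_on J O (Id_on J)\<inverse>) O \<alpha> ^^ m O ?P m = ?P n O \<alpha> ^^ (n + m) O ?P m"
    if n: "0 < n" and m: "0 < m" for n m
  proof
    show "?P n O \<alpha> ^^ n O (Id_on J O (Id_on J)\<inverse>) O \<alpha> ^^ m O ?P m \<subseteq> ?P n O \<alpha> ^^ (n + m) O ?P m"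
      unfolding relpow_add by auto
    show "?P n O \<alpha> ^^ (n + m) O ?P m \<subseteq> ?P n O \<alpha> ^^ n O (Id_on J O (Id_on J)\<inverse>) O \<alpha> ^^ m O ?P m"
    proof
      fix xz assume "xz \<in> ?P n O \<alpha> ^^ (n + m) O ?P m"
      then obtain x y z where xz: "xz = (x, z)" and x: "(x, x) \<in> ?P n" and z: "(z, z) \<in> ?P m"
        and xy: "(x, y) \<in> \<alpha> ^^ n" and yz: "(y, z) \<in> \<alpha> ^^ m"
        unfolding relpow_add by (auto simp: P split: if_splits)
      have "y \<in> J"
      proof (rule between[OF xy yz])
        show "x \<in> carrier A" using xy linear_relationD(1)[OF linear_relation_relpow[OF \<alpha> A n] A A] by blast
        show "z \<in> carrier A" using yz linear_relationD(1)[OF linear_relation_relpow[OF \<alpha> A m] A A] by blast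
      qed (use x z in \<open>auto simp: P split: if_splits\<close>)
      then show "xz \<in> ?P n O \<alpha> ^^ n O (Id_on J O (Id_on J)\<inverse>) O \<alpha> ^^ m O ?P m"
        using xz x z xy yz by blast
    qed
  qed
  show "shift_equivalent R A \<alpha> I \<beta>"
    unfolding \<beta>_def by (rule shift_equivalent_subquotient[OF A I \<alpha> \<rho> onto \<open>0 < N\<close> glue])
  show "bijective_on (carrier I) \<beta>"
    if zero1: "\<And>y. (\<zero>\<^bsub>A\<^esub>, y) \<in> \<alpha> \<Longrightarrow> y = \<zero>\<^bsub>A\<^esub>" and zero2: "\<And>y. (y, \<zero>\<^bsub>A\<^esub>) \<in> \<alpha> \<Longrightarrow> y = \<zero>\<^bsub>A\<^esub>"
  proof -
    note \<alpha>_sub = linear_relationD(1)[OF \<alpha> A A]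
    have eq: "x = x'" if "x \<ominus>\<^bsub>A\<^esub> x' = \<zero>\<^bsub>A\<^esub>" "x \<in> carrier A" "x' \<in> carrier A" for x x'
    proof -
      have "x = (x \<ominus>\<^bsub>A\<^esub> x') \<oplus>\<^bsub>A\<^esub> x'" using that(2,3) by (simp add: M.minus_eq M.a_assoc M.l_neg)
      then show ?thesis using that by simp
    qed
    have inj: "x = x'" if "(x, y) \<in> \<alpha>" "(x', y) \<in> \<alpha>" for x x' y
    proof -
      have carr: "x \<in> carrier A" "x' \<in> carrier A" "y \<in> carrier A" using that \<alpha>_sub by auto
      have "(x \<ominus>\<^bsub>A\<^esub> x', \<zero>\<^bsub>A\<^esub>) \<in> \<alpha>"
        using linear_relationD(5)[OF \<alpha> A A that] carr(3) by (simp add: M.minus_eq M.r_neg)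
      then show ?thesis using zero2 eq carr(1,2) by blast
    qed
    have single: "y = y'" if "(x, y) \<in> \<alpha>" "(x, y') \<in> \<alpha>" for x y y'
    proof -
      have carr: "y \<in> carrier A" "y' \<in> carrier A" "x \<in> carrier A" using that \<alpha>_sub by auto
      have "(\<zero>\<^bsub>A\<^esub>, y \<ominus>\<^bsub>A\<^esub> y') \<in> \<alpha>"
        using linear_relationD(5)[OF \<alpha> A A that] carr(3) by (simp add: M.minus_eq M.r_neg)
      then show ?thesis using zero1 eq carr(1,2) by blast
    qed
    have succ: "\<exists>y\<in>J. (x, y) \<in> \<alpha>" if "x \<in> J" for x
    proof -
      have "x \<in> ((\<alpha>\<inverse>) ^^ (1 + N)) `` carrier A"
        using that unfolding J_def in_gim_iff[OF A \<alpha>] by blast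
      then obtain z where "z \<in> carrier A" "(x, z) \<in> \<alpha> ^^ (1 + N)"
        unfolding converse_relpow[symmetric] by blast
      then obtain y where xy: "(x, y) \<in> \<alpha> ^^ 1" and yz: "(y, z) \<in> \<alpha> ^^ N"
        unfolding relpow_add by blast
      have "y \<in> J" by (rule between[OF xy yz]) (use that J' \<open>z \<in> carrier A\<close> in auto)
      then show ?thesis using xy by auto
    qed
    have pred: "\<exists>x\<in>J. (x, y) \<in> \<alpha>" if "y \<in> J" for y
    proof -
      have "y \<in> (\<alpha> ^^ (N + 1)) `` carrier A"
        using that unfolding J_def in_gim_iff[OF A \<alpha>] by blast
      then obtain w x where "w \<in> carrier A" and wx: "(w, x) \<in> \<alpha> ^^ N" and xy: "(x, y) \<in> \<alpha> ^^ 1"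
        unfolding relpow_add by blast
      have "x \<in> J" by (rule between[OF wx xy]) (use that J' \<open>w \<in> carrier A\<close> in auto)
      then show ?thesis using xy by auto
    qed
    have \<beta>_iff: "(x, y) \<in> \<beta> \<longleftrightarrow> x \<in> J \<and> y \<in> J \<and> (x, y) \<in> \<alpha>" for x y
      by (auto simp: \<beta>_def)
    have "\<beta> O \<beta>\<inverse> \<subseteq> Id_on J" by (auto simp: \<beta>_iff Id_on_iff intro: inj)
    moreover have "\<beta>\<inverse> O \<beta> \<subseteq> Id_on J" by (auto simp: \<beta>_iff Id_on_iff intro: single)
    moreover have "Id_on J \<subseteq> \<beta> O \<beta>\<inverse>"
      by (auto simp: \<beta>_iff Id_on_iff relcomp_unfold dest: succ)
    moreover have "Id_on J \<subseteq> \<beta>\<inverse> O \<beta>"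
      by (auto simp: \<beta>_iff Id_on_iff relcomp_unfold dest: pred)
    ultimately show ?thesis unfolding bijective_on_def I_def by simp
  qed
qed

section \<open>The Leray reduction\<close>

lemma
  assumes obj: "(A, \<alpha>) \<in> Obj (End (FRel R))"
    and Leray: "Leray R (A, \<alpha>) = (L, \<mu>)"
  shows Leray_in_Obj:
      "(L, \<mu>) \<in> Obj (End (FRel R))"
    and bijective_Leray:
      "bijective_on (carrier L) \<mu>"
    and shift_equivalent_Leray:
      "shift_equivalent R A \<alpha> L \<mu>"
proof -
  have A: "module R A" "linear_relation R A A \<alpha>" "finite_length R A"
    using obj by (auto simp: End_FRel_simps)
  obtain Q \<beta> where LM: "LM R (A, \<alpha>) = (Q, \<beta>)" by fastforce
  have LE: "LE R (Q, \<beta>) = (L, \<mu>)" using Leray LM by (simp add: Leray_def)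
  note Q = module_LM[OF A LM] linear_relation_LM[OF A LM] finite_length_LM[OF A LM]
  note L = module_LE[OF Q LE] linear_relation_LE[OF Q LE] finite_length_LE[OF Q LE]
  show "(L, \<mu>) \<in> Obj (End (FRel R))" using L by (simp add: End_FRel_simps)
  show "bijective_on (carrier L) \<mu>"
    using bijective_LE[OF Q LE] LM_image_zero[OF A LM] LM_preimage_zero[OF A LM] by blast
  show "shift_equivalent R A \<alpha> L \<mu>"
    by (rule shift_equivalent_trans[OF A(1) Q(1) L(1)
          shift_equivalent_LM[OF A LM] shift_equivalent_LE[OF Q LE]])
qed

theorem theorem2p2:
  fixes R :: "('r, 'x) ring_scheme"
    and A B :: "('r, 'a) module"
    and \<alpha> \<beta> :: "('a \<times> 'a) set"
  assumes "cring R"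
    and "(A, \<alpha>) \<in> Obj (End (FRel R))"
    and "(B, \<beta>) \<in> Obj (End (FRel R))"
  shows "isomorphic_in (Szym (FRel R)) (A, \<alpha>) (B, \<beta>) \<longleftrightarrow>
         isomorphic_in (End (FRel R)) (Leray R (A, \<alpha>)) (Leray R (B, \<beta>))"
proof -
  obtain M \<mu> N \<nu> where M: "Leray R (A, \<alpha>) = (M, \<mu>)" and N: "Leray R (B, \<beta>) = (N, \<nu>)"
    by (meson surj_pair)
  note M' = Leray_in_Obj[OF assms(2) M] bijective_Leray[OF assms(2) M]
    shift_equivalent_Leray[OF assms(2) M]
  note N' = Leray_in_Obj[OF assms(3) N] bijective_Leray[OF assms(3) N]
    shift_equivalent_Leray[OF assms(3) N]
  have mod: "module R A" "module R B" "module R M" "module R N"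
    using assms(2,3) M'(1) N'(1) by (auto simp: End_FRel_simps)
  have "isomorphic_in (Szym (FRel R)) (A, \<alpha>) (B, \<beta>) \<longleftrightarrow> shift_equivalent R A \<alpha> B \<beta>"
    by (rule Szym_isomorphic_iff_shift_equivalent[OF assms(2,3)])
  also have "\<dots> \<longleftrightarrow> shift_equivalent R M \<mu> N \<nu>"
    using M'(3) N'(3) mod by (meson shift_equivalent_sym shift_equivalent_trans)
  also have "\<dots> \<longleftrightarrow> isomorphic_in (End (FRel R)) (M, \<mu>) (N, \<nu>)"
    using End_isomorphic_iff_shift_equivalent[OF M'(1) N'(1) M'(2) N'(2)] by (rule sym)
  finally show ?thesis unfolding M N .
qed

end
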